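(* Let $(\mathbb{H},(\varphi_t)_{t\in\mathbb{R}})$ be the upper half-plane model of the hyperbolic plane, with the associated geodesic flow $\varphi_t:T_1(\mathbb{H})\to T_1(\mathbb{H})$, where $T_1(\mathbb{H})=\mathbb{H}\times S^1$ is the unit tangent bundle of $\mathbb{H}$. Define the group of isometries of $\mathbb{H}$ $$\Gamma(2)=\left\{z\mapsto\frac{az+b}{cz+d}:\ \begin{pmatrix}a&b\\c&d\end{pmatrix}\in SL(2,\mathbb{Z}),\ \begin{pmatrix}a&b\\c&d\end{pmatrix}\equiv\begin{pmatrix}1&0\\0&1\end{pmatrix}\ (\mathrm{mod}\ 2)\right\},$$ and let $M=\mathbb{H}/\Gamma(2)$ be the quotient space of $\mathbb{H}$ by $\Gamma(2)$, which has a fundamental domain $$F=\left\{z\in\mathbb{H}:\ |\mathrm{Re}\,z|<1,\ \left|z\pm\tfrac12\right|>\tfrac12\right\}.$$ Let $\pi:\mathbb{H}\to M$ be the quotient map, and let $(\overline{\varphi}_t)_{t\in\mathbb{R}}$ be the geodesic flow on $M$. Let $X'\subset T_1(\mathbb{H})$, $$X'=\{(z,u)\in\partial F\times S^1:\ z+\epsilon u\in F\text{ for small }\epsilon>0\},$$ and let $X\subset T_1(M)$, $X=d\pi(X')$, be the natural section of $M$ corresponding to the fundamental domain $F$, of all inward-pointing vectors on the boundary of $F$. Let $\tau:X\to X$ be the section- or first-return map of the geodesic flow, namely $\tau(\omega)=\overline{\varphi}_{t_\omega}(\omega)$, where $t_\omega=\inf\{t>0:\overline{\varphi}_t(\omega)\in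 X\}$. Then the section map $(X,\tau)$ admits the map $(\mathcal{Q},T)$ as a factor. That is, there exists an (explicit) function $E:X\to\mathcal{Q}$ such that $T\circ E=E\circ\tau$.
   Context: Here $\mathcal{Q}=\{(x,y):x>0,\ y>0,\ x^2+y^2=1\}$ is the positive quadrant of the unit circle, and $T:\mathcal{Q}\to\overline{\mathcal{Q}}$ is the transformation into its closure given by $$T(x,y)=\left(\frac{|2-x-2y|}{3-2x-2y},\frac{|2-2x-y|}{3-2x-2y}\right).$$ $T_1(M)$ is the unit tangent bundle of $M$. *)

theory Defs
  imports "HOL-Analysis.Analysis" "HOL-Number_Theory.Cong"
begin

definition upper_half_plane :: "complex set" where
  "upper_half_plane = {z. Im z > 0}"

text \<open>
  A pair \<open>(z, u)\<close> with \<open>cmod u = 1\<close> stands for the tangent vector at \<open>z\<close> with Euclidean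
  direction \<open>u\<close>. Its representative of unit length for the hyperbolic metric
  \<open>\<bar>dz\<bar> / Im z\<close> is \<open>Im z *\<^sub>R u\<close>.
\<close>

type_synonym tangent = "complex \<times> complex"

definition T1H :: "tangent set" where
  "T1H = upper_half_plane \<times> sphere 0 1"

definition hyp_dist :: "complex \<Rightarrow> complex \<Rightarrow> real" where
  "hyp_dist z w = arcosh (1 + (cmod (z - w))\<^sup>2 / (2 * Im z * Im w))"

text \<open>All geodesics of the hyperbolic plane are globally distance minimising.\<close>

definition unit_speed_geodesic :: "(real \<Rightarrow> complex) \<Rightarrow> bool" where
  "unit_speed_geodesic c \<longleftrightarrow>
     range c \<subseteq> upper_half_plane \<and> (\<forall>s t. hyp_dist (c s) (c t) = \<bar>s - t\<bar>)"

definition geodesic_of :: "tangent \<Rightarrow> real \<Rightarrow> complex" where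
  "geodesic_of v =
     (THE c. unit_speed_geodesic c \<and> c 0 = fst v \<and>
             (c has_vector_derivative (Im (fst v) *\<^sub>R snd v)) (at 0))"

definition geodesic_flow :: "real \<Rightarrow> tangent \<Rightarrow> tangent" where
  "geodesic_flow t v =
     (geodesic_of v t, sgn (vector_derivative (geodesic_of v) (at t)))"

definition Gamma2 :: "(complex \<Rightarrow> complex) set" where
  "Gamma2 = {moebius (of_int a) (of_int b) (of_int c) (of_int d) | a b c d :: int.
      a * d - b * c = 1 \<and>
      [a = 1] (mod 2) \<and> [b = 0] (mod 2) \<and> [c = 0] (mod 2) \<and> [d = 1] (mod 2)}"

definition tangent_map :: "(complex \<Rightarrow> complex) \<Rightarrow> tangent \<Rightarrow> tangent" where
  "tangent_map g v = (g (fst v), sgn (deriv g (fst v) * snd v))"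

text \<open>
  As transformations, the elements of \<open>Gamma2\<close> act freely and properly discontinuously, so
  the unit tangent bundle of the quotient surface is the quotient of \<open>T1H\<close> by the
  differentials of the elements of \<open>Gamma2\<close>. Its points are represented as orbits, and
  \<open>dpi\<close> is the differential of the quotient map.
\<close>

definition dpi :: "tangent \<Rightarrow> tangent set" where
  "dpi v = (\<lambda>g. tangent_map g v) ` Gamma2"

definition T1M :: "tangent set set" where
  "T1M = dpi ` T1H"

text \<open>The Borel sigma-algebra of the quotient topology on \<open>T1M\<close>.\<close>

definition T1M_borel :: "tangent set measure" where
  "T1M_borel = sigma T1M {U. U \<subseteq> T1M \<and> openin (top_of_set T1H) {v \<in> T1H. dpi v \<in> U}}"

text \<open>
  The flow on \<open>T1H\<close> commutes with the isometries in \<open>Gamma2\<close>, so it maps orbits onto orbits: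
  the image of \<open>dpi v\<close> is \<open>dpi (geodesic_flow t v)\<close>.
\<close>

definition quotient_flow :: "real \<Rightarrow> tangent set \<Rightarrow> tangent set" where
  "quotient_flow t \<omega> = geodesic_flow t ` \<omega>"

definition fundamental_domain :: "complex set" where
  "fundamental_domain =
     {z \<in> upper_half_plane. \<bar>Re z\<bar> < 1 \<and> cmod (z + 1/2) > 1/2 \<and> cmod (z - 1/2) > 1/2}"

text \<open>The boundary is taken inside the half-plane, which excludes the real points -1, 0, 1.\<close>

definition inward_vectors :: "tangent set" where
  "inward_vectors =
     {(z, u) \<in> T1H. z \<in> frontier fundamental_domain \<and>
        (\<forall>\<^sub>F \<epsilon> in at_right 0. z + of_real \<epsilon> * u \<in> fundamental_domain)}"

definition cross_section :: "tangent set set" where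
  "cross_section = dpi ` inward_vectors"

definition return_times :: "tangent set \<Rightarrow> real set" where
  "return_times \<omega> = {t. t > 0 \<and> quotient_flow t \<omega> \<in> cross_section}"

text \<open>
  The value is meaningful only if \<open>return_times \<omega>\<close> is nonempty. It is empty when the
  forward geodesic escapes to a cusp without crossing the boundary again.
\<close>

definition first_return :: "tangent set \<Rightarrow> tangent set" where
  "first_return \<omega> = quotient_flow (Inf (return_times \<omega>)) \<omega>"

definition quadrant :: "(real \<times> real) set" where
  "quadrant = {(x, y). x > 0 \<and> y > 0 \<and> x\<^sup>2 + y\<^sup>2 = 1}"

definition quadrant_map :: "real \<times> real \<Rightarrow> real \<times> real" where
  "quadrant_map = (\<lambda>(x, y).
     (\<bar>2 - x - 2 * y\<bar> / (3 - 2 * x - 2 * y), \<bar>2 - 2 * x - y\<bar> / (3 - 2 * x - 2 * y)))"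

text \<open>
  \<open>first_return\<close> is a partial map on \<open>cross_section\<close>, with domain the vectors that return, and
  \<open>quadrant_map\<close> is a partial map on \<open>quadrant\<close>, with domain the points whose image lies in
  \<open>quadrant\<close> and not merely in its closure. A factor map is a Borel measurable surjection for
  which the two compositions agree as partial maps, domains included. Continuity cannot be
  required: the definition of \<open>inward_vectors\<close> admits vectors tangent to the two semicircles,
  whose first return is immediate, so that they must go to the fixed point
  \<open>(1 / sqrt 2, 1 / sqrt 2)\<close> of \<open>quadrant_map\<close>. Surjectivity excludes the constant map to that
  fixed point.
\<close>

definition is_factor_map :: "(tangent set \<Rightarrow> real \<times> real) \<Rightarrow> bool" where
  "is_factor_map E \<longleftrightarrow>
     E ` cross_section = quadrant \<and>
     E \<in> borel_measurable (restrict_space T1M_borel cross_section) \<and>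
     (\<forall>\<omega> \<in> cross_section.
        if return_times \<omega> \<noteq> {}
        then first_return \<omega> \<in> cross_section \<and> quadrant_map (E \<omega>) = E (first_return \<omega>)
        else quadrant_map (E \<omega>) \<notin> quadrant)"

end

theory Submission
  imports Defs
begin

text \<open>
  Let an orbit \<open>\<omega>\<close> of the cross-section be represented by a vector \<open>v\<close> that enters the domain \<open>F\<close>
  transversally through a side \<open>j\<close>. The orbit has exactly one more lift at the boundary of \<open>F\<close>: the
  side pairing \<open>\<gamma>\<close> of \<open>j\<close> carries \<open>v\<close> to a vector that leaves \<open>F\<close> through the partner side. The
  factor map \<open>E\<close> sends \<open>\<omega>\<close> to a function \<open>P\<close> of the forward endpoint \<open>\<gamma> b\<close> of this outgoing
  vector, where \<open>b\<close> is the forward endpoint of \<open>v\<close> and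
  \<open>P \<beta> = (2 \<bar>\<beta>\<bar>, \<bar>\<beta>\<^sup>2 - 1\<bar>) / (\<beta>\<^sup>2 + 1)\<close> parametrises the quadrant.

  Two facts give the conjugation. First, \<open>T (P \<beta>) = P (\<beta> - 2)\<close> for \<open>\<beta> > 1\<close>, and \<open>P\<close> does not change
  under \<open>\<beta> \<mapsto> - \<beta>\<close> and \<open>\<beta> \<mapsto> 1 / \<beta>\<close>, symmetries of \<open>F\<close> and its side pairings that move each side
  to the line \<open>Re z = - 1\<close>, where \<open>\<gamma> b = b + 2\<close>. Therefore \<open>T (P (\<gamma> b)) = P b\<close>, that is
  \<open>T (E \<omega>) = P b\<close> (\<open>quadrant_map_pairing\<close>). Second, the flow follows \<open>v\<close> across \<open>F\<close> up to the vector that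
  leaves \<open>F\<close>; its orbit is the first return of \<open>\<omega>\<close>, and it is itself the outgoing lift that \<open>E\<close>
  evaluates there. Its forward endpoint is still \<open>b\<close>, so \<open>E (\<tau> \<omega>) = P b\<close>
  (\<open>enters_exit\<close>, \<open>factor_map_commutes_enters\<close>). If \<open>b\<close> is a cusp of \<open>F\<close>, the geodesic stays in \<open>F\<close>
  and \<open>P b\<close> is a corner of the closed quadrant. Vectors tangent to a semicircle return immediately
  and go to the fixed point of \<open>T\<close>.

  The geodesic flow is made explicit by frames, matrices in \<open>SL(2, \<real>)\<close> whose columns are the two
  endpoints of a geodesic; there the group acts on the left and the flow by a diagonal matrix on the
  right (\<open>geodesic_flow_frame\<close>). That \<open>E\<close> is well defined, and that no return happens inside
  \<open>F\<close>, rests on the fundamental domain property (\<open>Gamma2_fundamental\<close>). For measurability,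
  each side has a neighbourhood that meets the translates of the boundary of \<open>F\<close> in that
  side only, so the preimages of open sets in the transversal part of the cross-section are traces
  of open sets.
\<close>

section \<open>Real Moebius transformations as isometries\<close>

abbreviation real_moebius :: "real \<Rightarrow> real \<Rightarrow> real \<Rightarrow> real \<Rightarrow> complex \<Rightarrow> complex" where
  "real_moebius a b c d \<equiv> moebius (of_real a) (of_real b) (of_real c) (of_real d)"

lemma real_moebius_denom_nonzero:
  fixes a b c d :: real
  assumes "a * d - b * c = 1" "Im z > 0"
  shows "of_real c * z + of_real d \<noteq> 0"
proof
  assume *: "of_real c * z + of_real d = 0"
  have "c * Im z = 0" using arg_cong[OF *, of Im] by simp
  then have "c = 0" using assms by simp
  with arg_cong[OF *, of Re] have "d = 0" by simp
  with \<open>c = 0\<close> assms show False by simp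
qed

lemma Im_real_moebius:
  assumes "a * d - b * c = 1" "Im z > 0"
  shows "Im (real_moebius a b c d z) = Im z / (cmod (of_real c * z + of_real d))\<^sup>2"
proof -
  have "Im ((of_real a * z + of_real b) / (of_real c * z + of_real d))
      = (a * d - b * c) * Im z / (cmod (of_real c * z + of_real d))\<^sup>2"
    by (simp add: Im_divide cmod_power2) (simp add: algebra_simps power2_eq_square)
  then show ?thesis using assms by (simp add: moebius_def)
qed

lemma Im_real_moebius_pos:
  assumes "a * d - b * c = 1" "Im z > 0"
  shows "Im (real_moebius a b c d z) > 0"
  using assms real_moebius_denom_nonzero[OF assms] by (simp add: Im_real_moebius)

lemma real_moebius_diff:
  assumes "a * d - b * c = 1" "Im z > 0" "Im w > 0"
  shows "real_moebius a b c d z - real_moebius a b c d w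
       = (z - w) / ((of_real c * z + of_real d) * (of_real c * w + of_real d))"
proof -
  have nz: "of_real c * z + of_real d \<noteq> 0" "of_real c * w + of_real d \<noteq> 0"
    using assms real_moebius_denom_nonzero by blast+
  have det: "of_real a * of_real d - of_real b * of_real c = (1::complex)"
    using assms(1) by (metis of_real_1 of_real_diff of_real_mult)
  have "(of_real a * z + of_real b) * (of_real c * w + of_real d)
      - (of_real a * w + of_real b) * (of_real c * z + of_real d)
      = (of_real a * of_real d - of_real b * of_real c) * (z - w)"
    by (simp add: algebra_simps)
  with det nz show ?thesis
    by (simp add: moebius_def diff_frac_eq)
qed

lemma hyp_dist_real_moebius:
  assumes "a * d - b * c = 1" "Im z > 0" "Im w > 0"
  shows "hyp_dist (real_moebius a b c d z) (real_moebius a b c d w) = hyp_dist z w"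
proof -
  have nz: "cmod (of_real c * z + of_real d) \<noteq> 0" "cmod (of_real c * w + of_real d) \<noteq> 0"
    using assms real_moebius_denom_nonzero by (simp_all)
  show ?thesis
    using nz assms
    by (simp add: hyp_dist_def real_moebius_diff Im_real_moebius norm_divide norm_mult
        power_divide power_mult_distrib divide_simps)
qed

lemma real_moebius_has_field_derivative:
  assumes "a * d - b * c = 1" "Im z > 0"
  shows "(real_moebius a b c d has_field_derivative 1 / (of_real c * z + of_real d)\<^sup>2) (at z)"
proof -
  have nz: "of_real c * z + of_real d \<noteq> 0"
    using assms real_moebius_denom_nonzero by blast
  have det: "of_real a * of_real d - of_real b * of_real c = (1::complex)"
    using assms(1) by (metis of_real_1 of_real_diff of_real_mult)
  have "(real_moebius a b c d has_field_derivative
      (of_real a * (of_real c * z + of_real d) - (of_real a * z + of_real b) * of_real c)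
        / ((of_real c * z + of_real d) * (of_real c * z + of_real d))) (at z)"
    unfolding moebius_def using nz by (auto intro!: derivative_eq_intros)
  moreover have "of_real a * (of_real c * z + of_real d) - (of_real a * z + of_real b) * of_real c
      = (1::complex)"
    using det by (simp add: algebra_simps)
  ultimately show ?thesis by (simp add: power2_eq_square)
qed

section \<open>Geodesics\<close>

lemma cosh_hyp_dist:
  assumes "Im z > 0" "Im w > 0"
  shows "cosh (hyp_dist z w) = 1 + (cmod (z - w))\<^sup>2 / (2 * Im z * Im w)"
  unfolding hyp_dist_def using assms by (intro cosh_arcosh_real) simp

lemma unit_speed_geodesic_real_moebius:
  assumes "a * d - b * c = 1" "unit_speed_geodesic f"
  shows "unit_speed_geodesic (\<lambda>t. real_moebius a b c d (f t))"
proof -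
  have "Im (f t) > 0" for t
    using assms(2) by (auto simp: unit_speed_geodesic_def upper_half_plane_def)
  then show ?thesis
    using assms by (auto simp: unit_speed_geodesic_def upper_half_plane_def
      hyp_dist_real_moebius Im_real_moebius_pos)
qed

lemma imaginary_axis_has_vector_derivative:
  "((\<lambda>t. \<i> * of_real (exp t)) has_vector_derivative \<i> * of_real (exp t)) (at t)"
  by (intro has_vector_derivative_mult_right has_vector_derivative_of_real)
    (simp add: DERIV_exp)

lemma unit_speed_geodesic_imaginary_axis:
  "unit_speed_geodesic (\<lambda>t. \<i> * of_real (exp t))"
proof -
  have "hyp_dist (\<i> * of_real (exp s)) (\<i> * of_real (exp t)) = \<bar>s - t\<bar>" for s t :: real
  proof -
    have "(cmod (\<i> * of_real (exp s) - \<i> * of_real (exp t)))\<^sup>2 = (exp s - exp t)\<^sup>2"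
      by (simp add: cmod_power2)
    moreover have "1 + (exp s - exp t)\<^sup>2 / (2 * exp s * exp t) = cosh (s - t)"
      by (simp add: cosh_def exp_diff exp_minus field_simps power2_eq_square)
    then have "1 + (exp s - exp t)\<^sup>2 / (2 * exp s * exp t) = cosh \<bar>s - t\<bar>"
      by simp
    ultimately show ?thesis
      by (simp add: hyp_dist_def arcosh_cosh_real del: cosh_real_abs)
  qed
  then show ?thesis by (auto simp: unit_speed_geodesic_def upper_half_plane_def)
qed

text \<open>
  The derivative at \<open>0\<close> alone determines the whole curve. The function
  \<open>t \<mapsto> cosh (dist (f t) (f T))\<close> equals \<open>cosh (T - t)\<close>; its value and its derivative at \<open>t = 0\<close>
  give two equations for the coordinates of \<open>f T\<close> in which \<open>f\<close> enters only through
  \<open>f 0\<close> and \<open>f' 0\<close>. Their sum is linear in \<open>Im (f T)\<close>, and \<open>Re (f T)\<close> then has to vanish.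
\<close>

lemma unit_speed_geodesic_unique_upward:
  assumes geo: "unit_speed_geodesic f" and f0: "f 0 = \<i>"
    and der: "(f has_vector_derivative \<i>) (at 0)"
  shows "f T = \<i> * of_real (exp T)"
proof -
  define x y where "x = Re (f T)" and "y = Im (f T)"
  have pos: "Im (f t) > 0" for t
    using geo by (auto simp: unit_speed_geodesic_def upper_half_plane_def)
  have y: "y > 0" using pos by (simp add: y_def)
  have cosh_eq: "1 + ((Re (f t) - x)\<^sup>2 + (Im (f t) - y)\<^sup>2) / (2 * Im (f t) * y) = cosh (T - t)" for t
  proof -
    have "cosh (hyp_dist (f t) (f T)) = cosh (T - t)"
      using geo by (metis unit_speed_geodesic_def cosh_real_abs abs_minus_commute)
    then show ?thesis
      using cosh_hyp_dist[OF pos pos, of t T] by (simp add: cmod_power2 x_def y_def)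
  qed
  define X Y where "X = (\<lambda>t. Re (f t))" and "Y = (\<lambda>t. Im (f t))"
  have XY0: "X 0 = 0" "Y 0 = 1" using f0 by (simp_all add: X_def Y_def)
  have cosh_eq': "1 + ((X t - x)\<^sup>2 + (Y t - y)\<^sup>2) / (2 * Y t * y) = cosh (T - t)" for t
    using cosh_eq[of t] by (simp add: X_def Y_def)
  have dRe: "(X has_real_derivative 0) (at 0)"
    using bounded_linear.has_vector_derivative[OF bounded_linear_Re der]
    by (simp add: X_def Y_def has_real_derivative_iff_has_vector_derivative)
  have dIm: "(Y has_real_derivative 1) (at 0)"
    using bounded_linear.has_vector_derivative[OF bounded_linear_Im der]
    by (simp add: X_def Y_def has_real_derivative_iff_has_vector_derivative)
  have "((\<lambda>t. 1 + ((X t - x)\<^sup>2 + (Y t - y)\<^sup>2) / (2 * Y t * y)) has_real_derivative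
     (2 * (1 - y) * (2 * y) - (x\<^sup>2 + (1 - y)\<^sup>2) * (2 * y)) / (2 * y)\<^sup>2) (at 0)"
    using y XY0 by (auto intro!: derivative_eq_intros dRe dIm simp: power2_eq_square)
  moreover have "((\<lambda>t. cosh (T - t)) has_real_derivative - sinh T) (at 0)"
    by (auto intro!: derivative_eq_intros)
  ultimately have d: "(2 * (1 - y) * (2 * y) - (x\<^sup>2 + (1 - y)\<^sup>2) * (2 * y)) / (2 * y)\<^sup>2 = - sinh T"
    unfolding cosh_eq' by (rule DERIV_unique)
  have v: "1 + (x\<^sup>2 + (1 - y)\<^sup>2) / (2 * y) = cosh T"
    using cosh_eq[of 0] f0 by simp
  have v': "x\<^sup>2 + (1 - y)\<^sup>2 = 2 * y * (cosh T - 1)"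
    using v y by (simp add: field_simps)
  have "(2 * (1 - y) - (x\<^sup>2 + (1 - y)\<^sup>2)) / (2 * y) = - sinh T"
  proof -
    have "(A * (2 * y) - B * (2 * y)) / (2 * y)\<^sup>2 = (A - B) / (2 * y)" for A B
    proof -
      have "A * (2 * y) - B * (2 * y) = (A - B) * (2 * y)" by (simp add: left_diff_distrib)
      then show ?thesis using y by (simp add: power2_eq_square del: distrib_left_numeral
        distrib_right_numeral left_diff_distrib_numeral right_diff_distrib_numeral)
    qed
    then show ?thesis using d by simp
  qed
  then have d': "2 * (1 - y) - (x\<^sup>2 + (1 - y)\<^sup>2) = - (2 * y * sinh T)"
    using y by (simp add: field_simps)
  have "2 = 2 * y * (cosh T - sinh T)"
    using v' d' by (simp add: algebra_simps)
  then have "y * exp (-T) = 1" by (simp add: cosh_minus_sinh)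
  then have yT: "y = exp T" by (simp add: exp_minus field_simps)
  have "x\<^sup>2 = 2 * y * cosh T - 1 - y\<^sup>2"
    using v' by (simp add: algebra_simps power2_eq_square)
  also have "\<dots> = 0"
    by (simp add: yT cosh_def exp_minus field_simps power2_eq_square)
  finally have "x = 0" by simp
  with yT show ?thesis by (simp add: complex_eq_iff x_def y_def)
qed

section \<open>Frames\<close>

text \<open>
  The matrix with rows \<open>(a, b)\<close> and \<open>(c, d)\<close> and determinant \<open>1\<close> stands for the image of the
  upward vector at \<open>\<i>\<close> under \<open>z \<mapsto> (a z + b) / (c z + d)\<close>, which identifies the unit tangent
  bundle with \<open>PSL(2, \<real>)\<close>. An isometry acts by multiplication on the left and the geodesic
  flow by multiplication on the right with \<open>diag(exp (t/2), exp (-t/2))\<close>. The columns are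
  homogeneous coordinates of the two ends of the geodesic: \<open>a / c\<close> is the forward endpoint and
  \<open>b / d\<close> the backward one.
\<close>

definition frame :: "real \<Rightarrow> real \<Rightarrow> real \<Rightarrow> real \<Rightarrow> tangent" where
  "frame a b c d = (Complex b a / Complex d c, sgn (\<i> / (Complex d c)\<^sup>2))"

lemma frame_denom: "a * d - b * c = (1::real) \<Longrightarrow> Complex d c \<noteq> 0"
  by (auto simp: complex_eq_iff)

lemma frame_eq_tangent_map:
  assumes "a * d - b * c = 1"
  shows "frame a b c d = tangent_map (real_moebius a b c d) (\<i>, \<i>)"
proof -
  have "Complex d c = of_real c * \<i> + of_real d" "Complex b a = of_real a * \<i> + of_real b"
    by (simp_all add: complex_eq_iff)
  then show ?thesis
    using DERIV_imp_deriv[OF real_moebius_has_field_derivative[OF assms, of \<i>]]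
    by (simp add: frame_def tangent_map_def moebius_def)
qed

lemma Im_frame:
  assumes "a * d - b * c = 1"
  shows "Im (fst (frame a b c d)) = 1 / (c\<^sup>2 + d\<^sup>2)"
  using assms by (simp add: frame_def Im_divide field_simps power2_eq_square)

lemma Re_frame:
  "Re (fst (frame a b c d)) = (a * c + b * d) / (c\<^sup>2 + d\<^sup>2)"
  by (simp add: frame_def Re_divide field_simps power2_eq_square)

lemma frame_norm_pos:
  assumes "a * d - b * c = (1::real)"
  shows "c\<^sup>2 + d\<^sup>2 > 0"
proof -
  have "c \<noteq> 0 \<or> d \<noteq> 0" using assms by auto
  then show ?thesis by (simp add: sum_power2_gt_zero_iff)
qed

lemma direction_frame:
  assumes "a * d - b * c = 1"
  shows "snd (frame a b c d) = Complex (2 * c * d / (c\<^sup>2 + d\<^sup>2)) ((d\<^sup>2 - c\<^sup>2) / (c\<^sup>2 + d\<^sup>2))"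
proof -
  let ?w = "Complex d c"
  have pos: "c\<^sup>2 + d\<^sup>2 > 0" using frame_norm_pos[OF assms] .
  have n: "(cmod ?w)\<^sup>2 = c\<^sup>2 + d\<^sup>2" by (simp add: cmod_power2)
  have "\<i> / ?w\<^sup>2 = \<i> * (cnj ?w)\<^sup>2 / of_real ((c\<^sup>2 + d\<^sup>2)\<^sup>2)"
  proof -
    have "?w * cnj ?w = of_real (c\<^sup>2 + d\<^sup>2)"
      by (simp add: complex_eq_iff power2_eq_square)
    then have "of_real ((c\<^sup>2 + d\<^sup>2)\<^sup>2) = ?w\<^sup>2 * (cnj ?w)\<^sup>2"
      by (metis of_real_power power_mult_distrib)
    then show ?thesis using frame_denom[OF assms] by simp
  qed
  moreover have "cmod (\<i> / ?w\<^sup>2) = 1 / (c\<^sup>2 + d\<^sup>2)"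
    by (simp add: norm_divide norm_power n)
  ultimately have "sgn (\<i> / ?w\<^sup>2) = \<i> * (cnj ?w)\<^sup>2 / of_real (c\<^sup>2 + d\<^sup>2)"
    using pos by (simp add: sgn_div_norm scaleR_conv_of_real power2_eq_square)
  also have "\<dots> = Complex (2 * c * d / (c\<^sup>2 + d\<^sup>2)) ((d\<^sup>2 - c\<^sup>2) / (c\<^sup>2 + d\<^sup>2))"
    by (simp add: complex_eq_iff Re_divide_of_real Im_divide_of_real power2_eq_square del: of_real_add)
  finally show ?thesis by (simp add: frame_def)
qed

lemma frame_in_T1H:
  assumes "a * d - b * c = 1"
  shows "frame a b c d \<in> T1H"
proof -
  have "Im (fst (frame a b c d)) > 0"
    using frame_norm_pos[OF assms] by (simp add: Im_frame[OF assms])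
  moreover have "\<i> / (Complex d c)\<^sup>2 \<noteq> 0" using frame_denom[OF assms] by simp
  then have "norm (snd (frame a b c d)) = 1"
    unfolding frame_def snd_conv norm_sgn by (rule if_not_P)
  ultimately show ?thesis
    by (cases "frame a b c d") (auto simp: T1H_def upper_half_plane_def)
qed

lemma frame_exists:
  assumes "v \<in> T1H"
  obtains a b c d where "a * d - b * c = 1" "v = frame a b c d"
proof -
  obtain z u where v: "v = (z, u)" by (cases v)
  have y: "Im z > 0" and u: "cmod u = 1"
    using assms by (auto simp: v T1H_def upper_half_plane_def)
  have u0: "u \<noteq> 0" using u by auto
  \<comment> \<open>The bottom row is read off \<open>w = d + c \<i>\<close>, whose square is prescribed
    by the direction and the height.\<close>
  define w where "w = csqrt (\<i> / (u * of_real (Im z)))"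
  have w2: "w\<^sup>2 = \<i> / (u * of_real (Im z))" by (simp add: w_def)
  have w0: "w \<noteq> 0" using w2 u0 y by auto
  have nw: "(cmod w)\<^sup>2 = 1 / Im z"
    using arg_cong[OF w2, of cmod] y u by (simp add: norm_divide norm_mult norm_power)
  define m where "m = z * w"
  have "Im m * Re w - Re m * Im w = Im z * (cmod w)\<^sup>2"
    by (simp add: m_def cmod_power2) (simp add: algebra_simps power2_eq_square)
  then have "Im m * Re w - Re m * Im w = 1" using nw y by simp
  moreover have "\<i> / w\<^sup>2 = u * of_real (Im z)" using u0 y by (simp add: w2)
  then have "sgn (\<i> / w\<^sup>2) = u"
    using u y by (simp add: sgn_mult sgn_of_real) (simp add: sgn_div_norm)
  then have "v = frame (Im m) (Re m) (Im w) (Re w)"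
    using w0 by (simp add: v frame_def) (simp add: m_def)
  ultimately show thesis using that by blast
qed

lemma tangent_map_frame:
  assumes "\<alpha> * \<delta> - \<beta> * \<gamma> = 1" "a * d - b * c = 1"
  shows "tangent_map (real_moebius \<alpha> \<beta> \<gamma> \<delta>) (frame a b c d)
       = frame (\<alpha> * a + \<beta> * c) (\<alpha> * b + \<beta> * d) (\<gamma> * a + \<delta> * c) (\<gamma> * b + \<delta> * d)"
proof -
  let ?m = "Complex b a" and ?w = "Complex d c"
  have w: "?w \<noteq> 0" using frame_denom[OF assms(2)] .
  have Im: "Im (?m / ?w) > 0"
    using frame_in_T1H[OF assms(2)] by (simp add: frame_def T1H_def upper_half_plane_def)
  have nz: "of_real \<gamma> * (?m / ?w) + of_real \<delta> \<noteq> 0"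
    using real_moebius_denom_nonzero[OF assms(1) Im] .
  have w': "Complex (\<gamma> * b + \<delta> * d) (\<gamma> * a + \<delta> * c) = ?w * (of_real \<gamma> * (?m / ?w) + of_real \<delta>)"
    using w by (simp add: field_simps) (simp add: complex_eq_iff algebra_simps)
  have m': "Complex (\<alpha> * b + \<beta> * d) (\<alpha> * a + \<beta> * c) = ?w * (of_real \<alpha> * (?m / ?w) + of_real \<beta>)"
    using w by (simp add: field_simps) (simp add: complex_eq_iff algebra_simps)
  have "real_moebius \<alpha> \<beta> \<gamma> \<delta> (?m / ?w)
      = Complex (\<alpha> * b + \<beta> * d) (\<alpha> * a + \<beta> * c) / Complex (\<gamma> * b + \<delta> * d) (\<gamma> * a + \<delta> * c)"
    unfolding w' m' moebius_def using w by simp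
  moreover have "sgn (1 / (of_real \<gamma> * (?m / ?w) + of_real \<delta>)\<^sup>2 * sgn (\<i> / ?w\<^sup>2))
     = sgn (\<i> / (Complex (\<gamma> * b + \<delta> * d) (\<gamma> * a + \<delta> * c))\<^sup>2)"
    unfolding w' by (simp add: sgn_mult sgn_divide power_mult_distrib divide_simps)
  ultimately show ?thesis
    unfolding frame_def tangent_map_def
    by (simp add: DERIV_imp_deriv[OF real_moebius_has_field_derivative[OF assms(1) Im]])
qed

text \<open>
  By transport from the imaginary axis. Uniqueness, which the definite description needs,
  comes from pulling any competitor back by the inverse isometry.
\<close>

lemma geodesic_of_frame:
  assumes "a * d - b * c = 1"
  shows "geodesic_of (frame a b c d) = (\<lambda>t. real_moebius a b c d (\<i> * of_real (exp t)))"
    (is "_ = ?g")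
proof -
  let ?m = "real_moebius a b c d"
  obtain z u where v: "frame a b c d = (z, u)" by fastforce
  have z: "z = ?m \<i>" and u: "u = sgn (1 / (of_real c * \<i> + of_real d)\<^sup>2 * \<i>)"
    using v DERIV_imp_deriv[OF real_moebius_has_field_derivative[OF assms, of \<i>]]
    by (simp_all add: frame_eq_tangent_map[OF assms] tangent_map_def)
  have nz: "of_real c * \<i> + of_real d \<noteq> (0::complex)"
    using real_moebius_denom_nonzero[OF assms, of \<i>] by simp
  have Imz: "Im z = 1 / (cmod (of_real c * \<i> + of_real d))\<^sup>2"
    using Im_real_moebius[OF assms, of \<i>] z by simp
  have Imz_pos: "Im z > 0" using nz by (simp add: Imz)
  have speed: "Im z *\<^sub>R u = \<i> * (1 / (of_real c * \<i> + of_real d)\<^sup>2)"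
    using nz by (simp add: u Imz sgn_div_norm norm_divide norm_mult norm_power scaleR_conv_of_real)
  have der: "((\<lambda>t. \<i> * of_real (exp t)) has_vector_derivative \<i>) (at 0)"
    using imaginary_axis_has_vector_derivative[of 0] by simp
  have main: "unit_speed_geodesic ?g \<and> ?g 0 = z \<and> (?g has_vector_derivative Im z *\<^sub>R u) (at 0)"
  proof (intro conjI)
    show "unit_speed_geodesic ?g"
      using unit_speed_geodesic_real_moebius[OF assms unit_speed_geodesic_imaginary_axis] .
    show "?g 0 = z" by (simp add: z)
    show "(?g has_vector_derivative Im z *\<^sub>R u) (at 0)"
      unfolding speed
      using field_vector_diff_chain_at[OF der, of ?m "1 / (of_real c * \<i> + of_real d)\<^sup>2"]
        real_moebius_has_field_derivative[OF assms, of \<i>] by (simp add: o_def)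
  qed
  moreover have "f = ?g"
    if f: "unit_speed_geodesic f" "f 0 = z" "(f has_vector_derivative Im z *\<^sub>R u) (at 0)" for f
  proof -
    let ?n = "real_moebius d (-b) (-c) a"
    have det: "d * a - (-b) * (-c) = 1" using assms by (simp add: algebra_simps)
    have detc: "of_real a * of_real d - of_real b * of_real c = (1::complex)"
      using assms by (metis of_real_1 of_real_diff of_real_mult)
    then have detn: "of_real a * of_real d \<noteq> of_real b * (of_real c :: complex)"
      by (metis cancel_comm_monoid_add_class.diff_cancel zero_neq_one)
    have inv: "?n (?m w) = w" if "Im w > 0" for w
      using moebius_inverse[OF detn real_moebius_denom_nonzero[OF assms that]] by simp
    have inv': "?m (?n w) = w" if "Im w > 0" for w
    proof -
      have "of_real c * w - of_real a \<noteq> 0"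
        using real_moebius_denom_nonzero[OF det that] by (auto simp: algebra_simps)
      from moebius_inverse'[OF detn this] show ?thesis by simp
    qed
    have pos: "Im (f t) > 0" for t
      using f by (auto simp: unit_speed_geodesic_def upper_half_plane_def)
    have "((?n \<circ> f) has_vector_derivative Im z *\<^sub>R u * (1 / (of_real (-c) * z + of_real a)\<^sup>2)) (at 0)"
      by (rule field_vector_diff_chain_at[OF f(3)])
        (simp only: f(2) real_moebius_has_field_derivative[OF det Imz_pos])
    moreover have "Im z *\<^sub>R u * (1 / (of_real (-c) * z + of_real a)\<^sup>2) = \<i>"
    proof -
      have "of_real (-c) * z + of_real a = 1 / (of_real c * \<i> + of_real d)"
        unfolding z moebius_def using nz detc by (simp add: field_simps)
      then show ?thesis using nz unfolding speed by (simp add: power_divide)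
    qed
    ultimately have "((\<lambda>t. ?n (f t)) has_vector_derivative \<i>) (at 0)"
      by (simp add: o_def)
    moreover have "?n (f 0) = \<i>" using f(2) z inv[of \<i>] by simp
    ultimately have "?n (f t) = \<i> * of_real (exp t)" for t
      using unit_speed_geodesic_unique_upward[OF unit_speed_geodesic_real_moebius[OF det f(1)]] by blast
    then show ?thesis using inv'[OF pos] by metis
  qed
  ultimately show ?thesis unfolding geodesic_of_def v by (intro the_equality) auto
qed

lemma geodesic_flow_frame:
  assumes "a * d - b * c = 1"
  shows "geodesic_flow t (frame a b c d)
       = frame (a * exp (t / 2)) (b * exp (- (t / 2))) (c * exp (t / 2)) (d * exp (- (t / 2)))"
proof -
  let ?m = "real_moebius a b c d" and ?e = "exp (t / 2)"
  have ee: "exp t = ?e * ?e" by (simp flip: exp_add)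
  let ?w = "of_real c * (\<i> * of_real (exp t)) + of_real d :: complex"
  let ?W = "Complex (d * exp (- (t / 2))) (c * ?e)"
  have w: "?w = of_real ?e * ?W"
    by (simp add: complex_eq_iff ee exp_minus field_simps)
  have m: "of_real a * (\<i> * of_real (exp t)) + of_real b
      = of_real ?e * Complex (b * exp (- (t / 2))) (a * ?e)"
    by (simp add: complex_eq_iff ee exp_minus field_simps)
  have "((?m \<circ> (\<lambda>t. \<i> * of_real (exp t))) has_vector_derivative
      (\<i> * of_real (exp t)) * (1 / ?w\<^sup>2)) (at t)"
    by (rule field_vector_diff_chain_at[OF imaginary_axis_has_vector_derivative]) (rule real_moebius_has_field_derivative[OF assms], simp)
  then have "vector_derivative (geodesic_of (frame a b c d)) (at t) = \<i> * of_real (exp t) / ?w\<^sup>2"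
    unfolding geodesic_of_frame[OF assms] using vector_derivative_at by (fastforce simp: o_def)
  also have "\<dots> = \<i> / ?W\<^sup>2"
    unfolding w by (simp add: ee power2_eq_square)
  finally show ?thesis
    unfolding geodesic_flow_def frame_def[of "a * exp (t / 2)"]
    by (simp add: geodesic_of_frame[OF assms] moebius_def w m)
qed

lemma flow_det:
  fixes t :: real
  assumes "a * d - b * c = 1"
  shows "(a * exp (t / 2)) * (d * exp (- (t / 2))) - (b * exp (- (t / 2))) * (c * exp (t / 2)) = 1"
proof -
  have "exp (t / 2) * exp (- (t / 2)) = 1" by (simp flip: exp_add)
  then show ?thesis using assms by algebra
qed

lemma exp_half_square: "(exp (t / 2))\<^sup>2 = exp (t::real)"
  by (simp add: power2_eq_square flip: exp_add)

section \<open>The action of the group on tangent vectors\<close>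

lemma Gamma2E:
  assumes "g \<in> Gamma2"
  obtains a b c d :: int where "g = real_moebius (of_int a) (of_int b) (of_int c) (of_int d)"
    "a * d - b * c = 1" "odd a" "even b" "even c" "odd d"
proof -
  from assms obtain a b c d :: int
    where g: "g = moebius (of_int a) (of_int b) (of_int c) (of_int d)" "a * d - b * c = 1"
      and cong: "[a = 1] (mod 2)" "[b = 0] (mod 2)" "[c = 0] (mod 2)" "[d = 1] (mod 2)"
    unfolding Gamma2_def by blast
  show thesis
  proof
    show "g = real_moebius (of_int a) (of_int b) (of_int c) (of_int d)" using g by simp
    show "odd a" "even b" "even c" "odd d"
      using cong unfolding cong_def by presburger+
  qed (rule g)
qed

lemma Gamma2I:
  fixes a b c d :: int
  assumes "a * d - b * c = 1" "odd a" "even b" "even c" "odd d"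
  shows "real_moebius (of_int a) (of_int b) (of_int c) (of_int d) \<in> Gamma2"
proof -
  have "[a = 1] (mod 2)" "[b = 0] (mod 2)" "[c = 0] (mod 2)" "[d = 1] (mod 2)"
    using assms(2-) unfolding cong_def by presburger+
  then show ?thesis using assms(1) unfolding Gamma2_def of_real_of_int_eq by blast
qed

lemma det_of_int:
  fixes a b c d :: int
  assumes "a * d - b * c = 1"
  shows "of_int a * of_int d - of_int b * of_int c = (1::real)"
  using arg_cong[OF assms, of "of_int :: int \<Rightarrow> real"] by simp

lemma tangent_map_in_T1H:
  assumes "g \<in> Gamma2" "v \<in> T1H"
  shows "tangent_map g v \<in> T1H"
proof -
  from assms(1) obtain a b c d :: int
    where g: "g = real_moebius (of_int a) (of_int b) (of_int c) (of_int d)" "a * d - b * c = 1"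
    by (elim Gamma2E)
  from assms(2) obtain p q r s where v: "p * s - q * r = 1" "v = frame p q r s"
    by (elim frame_exists)
  have "(a * p + b * r) * (c * q + d * s) - (a * q + b * s) * (c * p + d * r)
      = (a * d - b * c) * (p * s - q * r)"
    by (simp add: algebra_simps)
  then show ?thesis
    unfolding g v(2) tangent_map_frame[OF det_of_int[OF g(2)] v(1)]
    by (intro frame_in_T1H) (simp add: v(1) det_of_int[OF g(2)])
qed

lemma Gamma2_identity:
  obtains e where "e \<in> Gamma2" "\<And>v. v \<in> T1H \<Longrightarrow> tangent_map e v = v"
proof
  show "real_moebius (of_int 1) (of_int 0) (of_int 0) (of_int 1) \<in> Gamma2"
    by (rule Gamma2I) auto
  show "tangent_map (real_moebius (of_int 1) (of_int 0) (of_int 0) (of_int 1)) v = v"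
    if "v \<in> T1H" for v
    using frame_exists[OF that] by (metis (no_types) add_0 add_0_right mult_1 mult_zero_left
        of_int_0 of_int_1 tangent_map_frame diff_zero)
qed

lemma Gamma2_compose:
  assumes "g \<in> Gamma2" "h \<in> Gamma2"
  obtains k where "k \<in> Gamma2"
    "\<And>v. v \<in> T1H \<Longrightarrow> tangent_map k v = tangent_map g (tangent_map h v)"
proof -
  from assms(1) obtain a b c d :: int
    where g: "g = real_moebius (of_int a) (of_int b) (of_int c) (of_int d)" "a * d - b * c = 1"
      "odd a" "even b" "even c" "odd d"
    by (elim Gamma2E)
  from assms(2) obtain a' b' c' d' :: int
    where h: "h = real_moebius (of_int a') (of_int b') (of_int c') (of_int d')" "a' * d' - b' * c' = 1"
      "odd a'" "even b'" "even c'" "odd d'"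
    by (elim Gamma2E)
  have det: "(a * a' + b * c') * (c * b' + d * d') - (a * b' + b * d') * (c * a' + d * c') = 1"
  proof -
    have "(a * a' + b * c') * (c * b' + d * d') - (a * b' + b * d') * (c * a' + d * c')
      = (a * d - b * c) * (a' * d' - b' * c')"
      by (simp add: algebra_simps)
    then show ?thesis by (simp add: g h)
  qed
  let ?k = "real_moebius (of_int (a * a' + b * c')) (of_int (a * b' + b * d'))
      (of_int (c * a' + d * c')) (of_int (c * b' + d * d'))"
  show thesis
  proof
    show "?k \<in> Gamma2" by (rule Gamma2I) (use det g h in auto)
    show "tangent_map ?k v = tangent_map g (tangent_map h v)" if "v \<in> T1H" for v
    proof -
      from that obtain p q r s where v: "p * s - q * r = 1" "v = frame p q r s"
        by (elim frame_exists)
      have d2: "(a' * p + b' * r) * (c' * q + d' * s) - (a' * q + b' * s) * (c' * p + d' * r) = 1"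
      proof -
        have "(a' * p + b' * r) * (c' * q + d' * s) - (a' * q + b' * s) * (c' * p + d' * r)
          = (a' * d' - b' * c') * (p * s - q * r)"
          by (simp add: algebra_simps)
        then show ?thesis using v h det_of_int[OF h(2)] by simp
      qed
      show ?thesis
        unfolding g(1) h(1) v(2) tangent_map_frame[OF det_of_int[OF h(2)] v(1)]
          tangent_map_frame[OF det_of_int[OF g(2)] d2] tangent_map_frame[OF det_of_int[OF det] v(1)]
        by (simp add: algebra_simps)
    qed
  qed
qed

lemma Gamma2_inverse:
  assumes "g \<in> Gamma2"
  obtains k where "k \<in> Gamma2" "\<And>v. v \<in> T1H \<Longrightarrow> tangent_map k (tangent_map g v) = v"
proof -
  from assms(1) obtain a b c d :: int
    where g: "g = real_moebius (of_int a) (of_int b) (of_int c) (of_int d)" "a * d - b * c = 1"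
      "odd a" "even b" "even c" "odd d"
    by (elim Gamma2E)
  have det: "d * a - (-b) * (-c) = 1" using g by (simp add: algebra_simps)
  let ?k = "real_moebius (of_int d) (of_int (-b)) (of_int (-c)) (of_int a)"
  show thesis
  proof
    show "?k \<in> Gamma2" by (rule Gamma2I) (use det g in auto)
    show "tangent_map ?k (tangent_map g v) = v" if "v \<in> T1H" for v
    proof -
      from that obtain p q r s where v: "p * s - q * r = 1" "v = frame p q r s"
        by (elim frame_exists)
      note D = det_of_int[OF g(2)]
      have d2: "(a * p + b * r) * (c * q + d * s) - (a * q + b * s) * (c * p + d * r) = 1"
      proof -
        have "(a * p + b * r) * (c * q + d * s) - (a * q + b * s) * (c * p + d * r)
          = (a * d - b * c) * (p * s - q * r)"
          by (simp add: algebra_simps)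
        then show ?thesis using v D by simp
      qed
      have e: "d * (a * x + b * y) + (-b) * (c * x + d * y) = x"
          "(-c) * (a * x + b * y) + a * (c * x + d * y) = y" for x y :: real
      proof -
        have "d * (a * x + b * y) + (-b) * (c * x + d * y) = (a * d - b * c) * x"
          "(-c) * (a * x + b * y) + a * (c * x + d * y) = (a * d - b * c) * y"
          by (simp_all add: algebra_simps)
        then show "d * (a * x + b * y) + (-b) * (c * x + d * y) = x"
          "(-c) * (a * x + b * y) + a * (c * x + d * y) = y" using D by simp_all
      qed
      show ?thesis
        unfolding g(1) v(2) tangent_map_frame[OF D v(1)]
          tangent_map_frame[OF det_of_int[OF det] d2]
        using e by simp
    qed
  qed
qed

lemma geodesic_flow_in_T1H:
  assumes "v \<in> T1H"
  shows "geodesic_flow t v \<in> T1H"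
proof -
  from assms obtain a b c d where v: "a * d - b * c = 1" "v = frame a b c d"
    by (elim frame_exists)
  show ?thesis
    unfolding v(2) geodesic_flow_frame[OF v(1)] by (intro frame_in_T1H flow_det v(1))
qed

text \<open>
  Left and right multiplication of matrices commute.
\<close>

lemma geodesic_flow_tangent_map:
  assumes "g \<in> Gamma2" "v \<in> T1H"
  shows "geodesic_flow t (tangent_map g v) = tangent_map g (geodesic_flow t v)"
proof -
  from assms(1) obtain a b c d :: int
    where g: "g = real_moebius (of_int a) (of_int b) (of_int c) (of_int d)" "a * d - b * c = 1"
    by (elim Gamma2E)
  from assms(2) obtain p q r s where v: "p * s - q * r = 1" "v = frame p q r s"
    by (elim frame_exists)
  note D = det_of_int[OF g(2)]
  have d1: "(a * p + b * r) * (c * q + d * s) - (a * q + b * s) * (c * p + d * r) = 1"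
    using v(1) D by algebra
  note d2 = flow_det[OF v(1), of t]
  show ?thesis
    unfolding g(1) v(2) tangent_map_frame[OF D v(1)] geodesic_flow_frame[OF v(1)]
      geodesic_flow_frame[OF d1] tangent_map_frame[OF D d2]
    by (simp add: algebra_simps)
qed

lemma dpi_eq_iff:
  assumes "v \<in> T1H" "w \<in> T1H"
  shows "dpi v = dpi w \<longleftrightarrow> (\<exists>g\<in>Gamma2. w = tangent_map g v)"
proof
  assume eq: "dpi v = dpi w"
  obtain e where "e \<in> Gamma2" "tangent_map e w = w"
    using Gamma2_identity assms(2) by metis
  then have "w \<in> dpi w" unfolding dpi_def by (intro image_eqI[of _ _ e]) auto
  then have "w \<in> dpi v" by (simp only: eq)
  then show "\<exists>g\<in>Gamma2. w = tangent_map g v" unfolding dpi_def by (auto simp: image_iff)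
next
  have sub: "dpi (tangent_map g v) \<subseteq> dpi v" if "g \<in> Gamma2" "v \<in> T1H" for g v
  proof
    fix x assume "x \<in> dpi (tangent_map g v)"
    then obtain h where "h \<in> Gamma2" "x = tangent_map h (tangent_map g v)"
      by (auto simp: dpi_def)
    moreover from this that obtain k where "k \<in> Gamma2" "tangent_map k v = tangent_map h (tangent_map g v)"
      using Gamma2_compose[of h g] by metis
    ultimately show "x \<in> dpi v" unfolding dpi_def by (intro image_eqI[of _ _ k]) auto
  qed
  assume "\<exists>g\<in>Gamma2. w = tangent_map g v"
  then obtain g where g: "g \<in> Gamma2" "w = tangent_map g v" by blast
  obtain k where k: "k \<in> Gamma2" "tangent_map k w = v"
    using Gamma2_inverse[OF g(1)] assms(1) g(2) by metis
  show "dpi v = dpi w"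
    using sub[OF g(1) assms(1)] sub[OF k(1) assms(2)] unfolding g(2)[symmetric] k(2)
    by (rule equalityI[rotated])
qed

lemma quotient_flow_dpi:
  assumes "v \<in> T1H"
  shows "quotient_flow t (dpi v) = dpi (geodesic_flow t v)"
  using geodesic_flow_tangent_map[OF _ assms]
  by (auto simp: quotient_flow_def dpi_def image_image)

section \<open>The sides of the fundamental domain\<close>

datatype side = Left_Line | Right_Line | Left_Arc | Right_Arc

lemma UNIV_side: "UNIV = {Left_Line, Right_Line, Left_Arc, Right_Arc}"
  using side.exhaust by auto

lemma all_side_iff:
  "(\<forall>j. P j) \<longleftrightarrow> P Left_Line \<and> P Right_Line \<and> P Left_Arc \<and> P Right_Arc"
  by (metis side.exhaust)

lemma ex_side_iff:
  "(\<exists>j. P j) \<longleftrightarrow> P Left_Line \<or> P Right_Line \<or> P Left_Arc \<or> P Right_Arc"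
  by (metis side.exhaust)

instance side :: finite by standard (simp add: UNIV_side)

text \<open>
  The fundamental domain is an ideal quadrilateral. Each side is the zero set of a function that
  is positive on the inner side; for the two semicircles, \<open>\<bar>z \<plusminus> 1/2\<bar> > 1/2\<close> is rewritten
  as \<open>\<bar>z\<bar>\<^sup>2 \<plusminus> Re z > 0\<close>. The next two functions are the terms of its exact
  second-order expansion along a Euclidean line.
\<close>

fun side_fun :: "side \<Rightarrow> complex \<Rightarrow> real" where
  "side_fun Left_Line z = 1 + Re z"
| "side_fun Right_Line z = 1 - Re z"
| "side_fun Left_Arc z = (cmod z)\<^sup>2 + Re z"
| "side_fun Right_Arc z = (cmod z)\<^sup>2 - Re z"

fun side_slope :: "side \<Rightarrow> complex \<Rightarrow> complex \<Rightarrow> real" where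
  "side_slope Left_Line z u = Re u"
| "side_slope Right_Line z u = - Re u"
| "side_slope Left_Arc z u = 2 * (Re z * Re u + Im z * Im u) + Re u"
| "side_slope Right_Arc z u = 2 * (Re z * Re u + Im z * Im u) - Re u"

fun side_curvature :: "side \<Rightarrow> real" where
  "side_curvature Left_Line = 0"
| "side_curvature Right_Line = 0"
| "side_curvature Left_Arc = 1"
| "side_curvature Right_Arc = 1"

lemma side_fun_along_line:
  "side_fun j (z + of_real \<epsilon> * u)
     = side_fun j z + \<epsilon> * side_slope j z u + \<epsilon>\<^sup>2 * (side_curvature j * (cmod u)\<^sup>2)"
  by (cases j) (simp_all add: cmod_power2, simp_all add: algebra_simps power2_eq_square)

text \<open>
  Adjacent sides meet only at the cusps, which are not points of the half-plane. So every
  boundary point lies on a single side.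
\<close>

lemma side_fun_pos_if_zero:
  assumes "Im z > 0" "side_fun j z = 0" "k \<noteq> j"
  shows "side_fun k z > 0"
proof -
  define x m where "x = Re z" and "m = (cmod z)\<^sup>2"
  have m: "m > x\<^sup>2" using assms(1) by (simp add: x_def m_def cmod_power2)
  have arc: "0 < s \<and> s < 1" if "m = s" "x\<^sup>2 = s\<^sup>2" for s
  proof -
    have "s\<^sup>2 < s" using that m by simp
    moreover from this have "0 < s" using zero_le_power2[of s] by linarith
    ultimately show ?thesis by (simp add: power2_eq_square)
  qed
  show ?thesis
  proof (cases j)
    case Left_Line
    then have "x = -1" using assms(2) by (simp add: x_def)
    moreover from this have "m > 1" using m by simp
    ultimately show ?thesis using assms(3) Left_Line by (cases k) (simp_all flip: x_def m_def)
  next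
    case Right_Line
    then have "x = 1" using assms(2) by (simp add: x_def)
    moreover from this have "m > 1" using m by simp
    ultimately show ?thesis using assms(3) Right_Line by (cases k) (simp_all flip: x_def m_def)
  next
    case Left_Arc
    then have "m = - x" using assms(2) by (simp add: x_def m_def)
    then show ?thesis using assms(3) Left_Arc arc[of "- x"]
      by (cases k) (simp_all flip: x_def m_def)
  next
    case Right_Arc
    then have "m = x" using assms(2) by (simp add: x_def m_def)
    then show ?thesis using assms(3) Right_Arc arc[of x]
      by (cases k) (simp_all flip: x_def m_def)
  qed
qed

lemma fundamental_domain_iff:
  "z \<in> fundamental_domain \<longleftrightarrow> Im z > 0 \<and> (\<forall>j. side_fun j z > 0)"
proof -
  have "cmod w > 1/2 \<longleftrightarrow> (Re w)\<^sup>2 + (Im w)\<^sup>2 > 1/4" for w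
  proof -
    have "cmod w > 1/2 \<longleftrightarrow> (cmod w)\<^sup>2 > (1/2)\<^sup>2"
      using power2_less_imp_less[of "1/2" "cmod w"] power_strict_mono[of "1/2" "cmod w" 2] by auto
    then show ?thesis unfolding cmod_power2 by (simp add: power_divide)
  qed
  from this[of "z + 1/2"] this[of "z - 1/2"] show ?thesis
    unfolding fundamental_domain_def upper_half_plane_def all_side_iff side_fun.simps cmod_power2
    by (simp add: abs_less_iff) (auto simp: power2_eq_square algebra_simps)
qed

lemma continuous_side_fun: "continuous_on A (side_fun j)"
  by (cases j) (auto intro!: continuous_intros simp: fun_eq_iff[symmetric] side_fun.simps[abs_def])

text \<open>
  Only the identity carries a point of the open domain into its closure. Put
  \<open>J = \<bar>c z + d\<bar>\<^sup>2\<close> with \<open>c\<close> even and \<open>d\<close> odd. Since \<open>\<bar>z\<bar>\<^sup>2 \<ge> \<bar>Re z\<bar>\<close>,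
  \<open>J \<ge> \<bar>Re z\<bar> (\<bar>c\<bar> - \<bar>d\<bar>)\<^sup>2 + (1 - \<bar>Re z\<bar>) d\<^sup>2\<close>, a convex combination of two
  integers that are at least \<open>1\<close> by parity. Hence an element with \<open>c \<noteq> 0\<close> strictly lowers every
  point of the domain, while its inverse, applied in the closure, never raises a point. This
  leaves \<open>c = 0\<close>, an even translation, for which the strip \<open>\<bar>Re z\<bar> < 1\<close> is too narrow.
\<close>

lemma Gamma2_fundamental:
  assumes v: "v \<in> T1H" "fst v \<in> fundamental_domain" and g: "g \<in> Gamma2"
    and closed: "\<And>j. side_fun j (fst (tangent_map g v)) \<ge> 0"
  shows "tangent_map g v = v"
proof -
  obtain z u where vz: "v = (z, u)" by (cases v)
  have z: "Im z > 0" "\<bar>Re z\<bar> < 1" "(cmod z)\<^sup>2 > \<bar>Re z\<bar>"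
    using v(2) by (auto simp: vz fundamental_domain_iff all_side_iff)
  have gz: "\<bar>Re (g z)\<bar> \<le> 1" "(cmod (g z))\<^sup>2 \<ge> \<bar>Re (g z)\<bar>"
    using closed[of Left_Line] closed[of Right_Line] closed[of Left_Arc] closed[of Right_Arc]
    by (auto simp: vz tangent_map_def abs_if)
  obtain a b c d :: int
    where gm: "g = real_moebius (of_int a) (of_int b) (of_int c) (of_int d)" "a * d - b * c = 1"
      "odd a" "even b" "even c" "odd d"
    using g by (elim Gamma2E)
  note D = det_of_int[OF gm(2)]
  have bound: "(cmod (of_real (of_int p) * w + of_real (of_int q)))\<^sup>2 \<ge> 1 + (p\<^sup>2) * ((cmod w)\<^sup>2 - \<bar>Re w\<bar>)"
    if pq: "even p" "odd q" and w: "\<bar>Re w\<bar> \<le> 1" for p q :: int and w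
  proof -
    define n where "n = \<bar>p\<bar> - \<bar>q\<bar>"
    have "n \<noteq> 0"
    proof
      assume "n = 0"
      then have "\<bar>p\<bar> = \<bar>q\<bar>" by (simp add: n_def)
      then show False using pq by (metis dvd_abs_iff)
    qed
    moreover have "q \<noteq> 0" using pq(2) by (intro notI) simp
    ultimately have "0 < n\<^sup>2" "0 < q\<^sup>2" by simp_all
    then have "1 \<le> n\<^sup>2" "1 \<le> q\<^sup>2" by linarith+
    then have "real_of_int 1 \<le> real_of_int (n\<^sup>2)" "real_of_int 1 \<le> real_of_int (q\<^sup>2)"
      by (simp_all only: of_int_le_iff)
    then have n: "1 \<le> (real_of_int n)\<^sup>2" and q: "1 \<le> (real_of_int q)\<^sup>2" by simp_all
    \<comment> \<open>The two squares of the convex combination, with \<open>N\<close> the difference of the absolute values.\<close>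
    define P Q N R where "P = real_of_int p" and "Q = real_of_int q" and "N = real_of_int n" and "R = \<bar>Re w\<bar>"
    have "N = \<bar>P\<bar> - \<bar>Q\<bar>" by (simp add: N_def P_def Q_def n_def)
    then have nn: "N\<^sup>2 = P\<^sup>2 - 2 * \<bar>P * Q\<bar> + Q\<^sup>2"
      by (simp add: power2_diff abs_mult)
    have "(Re (of_real P * w + of_real Q))\<^sup>2 + (Im (of_real P * w + of_real Q))\<^sup>2
        = P\<^sup>2 * ((Re w)\<^sup>2 + (Im w)\<^sup>2) + 2 * (P * Q) * Re w + Q\<^sup>2"
      by (simp add: power2_sum power_mult_distrib distrib_left)
    then have "(cmod (of_real P * w + of_real Q))\<^sup>2
        = P\<^sup>2 * (cmod w)\<^sup>2 + 2 * (P * Q) * Re w + Q\<^sup>2"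
      by (simp only: cmod_power2)
    moreover have "2 * (P * Q) * Re w \<ge> - (2 * \<bar>P * Q\<bar> * R)"
      using abs_ge_minus_self[of "2 * (P * Q) * Re w"] by (simp add: abs_mult R_def)
    moreover have "(N\<^sup>2 - 1) * R \<ge> 0"
      using n by (intro mult_nonneg_nonneg) (simp_all add: N_def R_def)
    moreover have "(Q\<^sup>2 - 1) * (1 - R) \<ge> 0"
      using q w by (intro mult_nonneg_nonneg) (simp_all add: Q_def R_def)
    ultimately have "(cmod (of_real P * w + of_real Q))\<^sup>2 \<ge> 1 + P\<^sup>2 * ((cmod w)\<^sup>2 - R)"
      unfolding nn by (simp add: algebra_simps)
    then show ?thesis by (simp add: P_def Q_def R_def)
  qed
  let ?J = "(cmod (of_real (of_int c) * z + of_real (of_int d)))\<^sup>2"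
  have Im_gz: "Im (g z) = Im z / ?J" unfolding gm(1) by (rule Im_real_moebius[OF D z(1)])
  have Im_gz_pos: "Im (g z) > 0" unfolding gm(1) by (rule Im_real_moebius_pos[OF D z(1)])
  have "c = 0"
  proof (rule ccontr)
    assume c: "c \<noteq> 0"
    then have "?J > 1"
    proof -
      have "(real_of_int c)\<^sup>2 * ((cmod z)\<^sup>2 - \<bar>Re z\<bar>) > 0"
        using c z by (intro mult_pos_pos) simp_all
      moreover have "?J \<ge> 1 + (real_of_int c)\<^sup>2 * ((cmod z)\<^sup>2 - \<bar>Re z\<bar>)"
        using bound[of c d z] gm z by simp
      ultimately show ?thesis by linarith
    qed
    then have less: "Im (g z) < Im z" using z(1) by (simp add: Im_gz divide_simps)
    have det: "of_int d * of_int a - of_int (-b) * of_int (-c) = (1::real)"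
      using D by (simp add: algebra_simps)
    have detn: "of_real (of_int a) * of_real (of_int d) \<noteq> of_real (of_int b) * (of_real (of_int c) :: complex)"
      using D unfolding of_real_mult[symmetric] of_real_eq_iff by linarith
    define K where "K = (cmod (of_real (of_int (-c)) * g z + of_real (of_int a)))\<^sup>2"
    have "real_moebius (of_int d) (of_int (-b)) (of_int (-c)) (of_int a) (g z) = z"
      unfolding gm(1) using moebius_inverse[OF detn real_moebius_denom_nonzero[OF D z(1)]] by simp
    then have Im_z: "Im z = Im (g z) / K"
      using Im_real_moebius[OF det Im_gz_pos] by (simp add: K_def)
    have "K \<ge> 1"
    proof -
      have "(real_of_int (-c))\<^sup>2 * ((cmod (g z))\<^sup>2 - \<bar>Re (g z)\<bar>) \<ge> 0"
        using gz by (intro mult_nonneg_nonneg) simp_all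
      moreover have "K \<ge> 1 + (real_of_int (-c))\<^sup>2 * ((cmod (g z))\<^sup>2 - \<bar>Re (g z)\<bar>)"
        unfolding K_def using gm gz by (intro order_trans[OF _ bound[of "-c" a "g z"]]) simp_all
      ultimately show ?thesis by linarith
    qed
    then have "Im (g z) / K \<le> Im (g z) / 1" using Im_gz_pos by (intro divide_left_mono) auto
    then have "Im z \<le> Im (g z)" by (simp only: Im_z div_by_1)
    with less show False by simp
  qed
  with gm(2) have "a * d = 1" by simp
  then have ad: "a = 1 \<and> d = 1 \<or> a = -1 \<and> d = -1" by (simp add: zmult_eq_1_iff)
  then have g_translation: "g = (\<lambda>z. z + of_int (b * d))"
    unfolding gm(1) moebius_def \<open>c = 0\<close> by (elim disjE conjE) simp_all
  have "Re (g z) = Re z + of_int (b * d)" by (simp add: g_translation)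
  then have "\<bar>real_of_int (b * d)\<bar> < 2" using z(2) gz(1) by linarith
  then have "\<bar>b * d\<bar> < 2" by linarith
  moreover obtain k where k: "b * d = 2 * k" using gm(4) by (metis dvd_def dvd_mult2)
  ultimately have "\<bar>2 * k\<bar> < 2" by (simp only: k)
  then have "k = 0" by arith
  with k have "b * d = 0" by simp
  moreover have "d \<noteq> 0" using ad by auto
  ultimately have "g = (\<lambda>z. z)" by (simp add: g_translation)
  moreover have "sgn u = u"
    using v(1) by (simp add: vz T1H_def sgn_div_norm)
  ultimately show ?thesis by (simp add: tangent_map_def vz)
qed

section \<open>Inward vectors\<close>

text \<open>
  Inward vectors are of two kinds: transversal ones, and vectors tangent to one of the two
  semicircles. The latter count as inward because the semicircles curve away from their Euclidean
  tangents; the two vertical sides contain their tangents.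
\<close>

definition enters :: "side \<Rightarrow> tangent \<Rightarrow> bool" where
  "enters j v \<longleftrightarrow> v \<in> T1H \<and> side_fun j (fst v) = 0 \<and> side_slope j (fst v) (snd v) > 0"

definition grazes :: "side \<Rightarrow> tangent \<Rightarrow> bool" where
  "grazes j v \<longleftrightarrow> v \<in> T1H \<and> side_curvature j = 1 \<and> side_fun j (fst v) = 0 \<and>
     side_slope j (fst v) (snd v) = 0"

lemma side_curvature_cases: "side_curvature j = 0 \<or> side_curvature j = 1"
  by (cases j) auto

lemma open_fundamental_domain: "open fundamental_domain"
proof -
  have "fundamental_domain = {z. Im z > 0} \<inter> (\<Inter>j. {z. side_fun j z > 0})"
    by (auto simp: fundamental_domain_iff)
  moreover have "open {z. Im z > 0}"
    by (intro open_Collect_less continuous_intros)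
  moreover have "open {z. side_fun j z > 0}" for j
    by (intro open_Collect_less continuous_side_fun continuous_intros)
  then have "open (\<Inter>j. {z. side_fun j z > 0})" by (intro open_INT) auto
  ultimately show ?thesis by (metis open_Int)
qed

lemma inward_if_enters_or_grazes:
  assumes "enters j v \<or> grazes j v"
  shows "v \<in> inward_vectors"
proof -
  obtain z u where v: "v = (z, u)" by (cases v)
  have y: "Im z > 0" and u: "cmod u = 1" and j0: "side_fun j z = 0" and T: "v \<in> T1H"
    using assms by (auto simp: v enters_def grazes_def T1H_def upper_half_plane_def)
  have path: "((\<lambda>\<epsilon>. z + of_real \<epsilon> * u) \<longlongrightarrow> z) (at_right 0)"
    by (auto intro!: tendsto_eq_intros)
  have side: "\<forall>\<^sub>F \<epsilon> in at_right 0. side_fun k (z + of_real \<epsilon> * u) > 0" for k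
  proof (cases "k = j")
    case True
    have "side_fun j (z + of_real \<epsilon> * u) > 0" if "\<epsilon> > 0" for \<epsilon>
      using assms that side_curvature_cases[of j] u j0
      by (auto simp: side_fun_along_line enters_def grazes_def v add_pos_pos)
    then show ?thesis unfolding True by (auto intro: eventually_at_rightI[of 0 1])
  next
    case False
    then have "side_fun k z > 0" using side_fun_pos_if_zero[OF y j0] by blast
    moreover have "((\<lambda>\<epsilon>. side_fun k (z + of_real \<epsilon> * u)) \<longlongrightarrow> side_fun k z) (at_right 0)"
      using continuous_side_fun[of UNIV k] path
      by (auto simp: continuous_on_eq_continuous_at intro: isCont_tendsto_compose)
    ultimately show ?thesis by (rule order_tendstoD(1)[rotated])
  qed
  have "\<forall>\<^sub>F \<epsilon> in at_right 0. Im (z + of_real \<epsilon> * u) > 0"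
    by (rule order_tendstoD(1)[OF tendsto_Im[OF path] y])
  moreover have "\<forall>\<^sub>F \<epsilon> in at_right 0. \<forall>k. side_fun k (z + of_real \<epsilon> * u) > 0"
    using side by (intro eventually_all_finite) auto
  ultimately have ev: "\<forall>\<^sub>F \<epsilon> in at_right 0. z + of_real \<epsilon> * u \<in> fundamental_domain"
    by eventually_elim (auto simp: fundamental_domain_iff)
  then have "z \<in> closure fundamental_domain"
    by (intro Lim_in_closed_set[OF closed_closure _ _ path])
      (auto elim!: eventually_mono intro: closure_subset[THEN subsetD])
  moreover have "z \<notin> fundamental_domain"
    using j0 by (auto simp: fundamental_domain_iff intro!: exI[of _ j])
  ultimately have "z \<in> frontier fundamental_domain"
    by (simp add: frontier_def interior_open[OF open_fundamental_domain])
  with ev T show ?thesis by (simp add: inward_vectors_def v)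
qed

lemma inward_vectors_iff: "v \<in> inward_vectors \<longleftrightarrow> (\<exists>j. enters j v \<or> grazes j v)"
proof
  assume inward: "v \<in> inward_vectors"
  obtain z u where v: "v = (z, u)" by (cases v)
  have T: "v \<in> T1H" and u: "cmod u = 1" and y: "Im z > 0"
    and fr: "z \<in> frontier fundamental_domain"
    and ev: "\<forall>\<^sub>F \<epsilon> in at_right 0. z + of_real \<epsilon> * u \<in> fundamental_domain"
    using inward by (auto simp: v inward_vectors_def T1H_def upper_half_plane_def)
  have "z \<notin> fundamental_domain" and cl: "z \<in> closure fundamental_domain"
    using fr by (simp_all add: frontier_def interior_open[OF open_fundamental_domain])
  then obtain j where "side_fun j z \<le> 0"
    using y by (auto simp: fundamental_domain_iff not_less)
  moreover have "closed {z. side_fun j z \<ge> 0}"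
    by (intro closed_Collect_le continuous_side_fun continuous_intros)
  then have "closure fundamental_domain \<subseteq> {z. side_fun j z \<ge> 0}"
    by (intro closure_minimal) (auto simp: fundamental_domain_iff less_imp_le)
  ultimately have j0: "side_fun j z = 0" using cl by force
  have pos: "\<forall>\<^sub>F \<epsilon> in at_right 0. side_slope j z u + \<epsilon> * side_curvature j > 0"
    using ev eventually_at_right_less[of 0]
  proof eventually_elim
    case (elim \<epsilon>)
    then have "0 < side_fun j (z + of_real \<epsilon> * u)" by (simp add: fundamental_domain_iff)
    then have "0 < \<epsilon> * (side_slope j z u + \<epsilon> * side_curvature j)"
      unfolding side_fun_along_line j0 u by (simp add: algebra_simps power2_eq_square)
    with elim show ?case by (simp add: zero_less_mult_iff)
  qed
  have lim: "((\<lambda>\<epsilon>. side_slope j z u + \<epsilon> * side_curvature j) \<longlongrightarrow> side_slope j z u) (at_right 0)"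
    by (auto intro!: tendsto_eq_intros)
  have "side_slope j z u \<ge> 0"
    by (rule tendsto_lowerbound[OF lim]) (use pos in \<open>auto elim: eventually_mono\<close>)
  moreover have "side_curvature j = 1" if "side_slope j z u = 0"
    using pos that side_curvature_cases[of j] by auto
  ultimately show "\<exists>j. enters j v \<or> grazes j v"
    using T j0 unfolding v enters_def grazes_def by (intro exI[of _ j]) auto
qed (use inward_if_enters_or_grazes in blast)

lemma side_fun_inward_nonneg:
  assumes "v \<in> inward_vectors"
  shows "side_fun k (fst v) \<ge> 0"
proof -
  from assms obtain j where "v \<in> T1H" "side_fun j (fst v) = 0"
    by (auto simp: inward_vectors_iff enters_def grazes_def)
  then show ?thesis
    using side_fun_pos_if_zero[of "fst v" j k] by (cases "k = j") (auto simp: T1H_def upper_half_plane_def)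
qed

lemma inward_not_interior:
  assumes "v \<in> inward_vectors"
  shows "fst v \<notin> fundamental_domain"
  using assms by (auto simp: inward_vectors_iff enters_def grazes_def fundamental_domain_iff)
    (metis less_irrefl)+

section \<open>Sides in terms of frames\<close>

text \<open>
  The quadratic form of a side vanishes at its two end points. On frames, the side function is, up
  to a positive factor, the sum of the form at the two columns. Along the flow it becomes
  \<open>exp t * P + exp (- t) * Q\<close> with the values \<open>P\<close>, \<open>Q\<close> of the form at the forward and the
  backward end. So every question on which sides a geodesic crosses, and when, concerns the signs
  of \<open>P\<close> and \<open>P + Q\<close>.
\<close>

fun side_form :: "side \<Rightarrow> real \<Rightarrow> real \<Rightarrow> real" where
  "side_form Left_Line r s = s * (s + r)"
| "side_form Right_Line r s = s * (s - r)"
| "side_form Left_Arc r s = r * (r + s)"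
| "side_form Right_Arc r s = r * (r - s)"

lemma side_form_scale: "side_form j (r * e) (s * e) = e\<^sup>2 * side_form j r s"
  by (cases j) (simp_all add: algebra_simps power2_eq_square)

lemma cmod_frame:
  assumes "a * d - b * c = 1"
  shows "(cmod (fst (frame a b c d)))\<^sup>2 = (a\<^sup>2 + b\<^sup>2) / (c\<^sup>2 + d\<^sup>2)"
  by (simp add: frame_def norm_divide power_divide cmod_power2 add.commute)

lemma side_fun_frame:
  assumes "a * d - b * c = 1"
  shows "side_fun j (fst (frame a b c d)) = (side_form j a c + side_form j b d) / (c\<^sup>2 + d\<^sup>2)"
proof -
  define N where "N = c\<^sup>2 + d\<^sup>2"
  have "N \<noteq> 0" using frame_norm_pos[OF assms] unfolding N_def by linarith
  then show ?thesis
    unfolding N_def[symmetric]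
    by (cases j) (simp_all add: cmod_frame[OF assms] Re_frame flip: N_def,
      simp_all add: divide_simps, simp_all add: N_def algebra_simps power2_eq_square)
qed

text \<open>
  Derivative of \<open>exp t * P + exp (- t) * Q\<close> at \<open>0\<close> when \<open>Q = - P\<close>.
\<close>

lemma side_slope_frame:
  assumes det: "a * d - b * c = 1" and zero: "side_form j a c + side_form j b d = 0"
  shows "side_slope j (fst (frame a b c d)) (snd (frame a b c d)) = 2 * side_form j a c"
proof -
  define N where "N = c\<^sup>2 + d\<^sup>2"
  have N: "N > 0" using frame_norm_pos[OF det] by (simp add: N_def)
  note u = direction_frame[OF det, folded N_def]
    and z = Re_frame[of a b c d, folded N_def] Im_frame[OF det, folded N_def]
  have inner: "Re (fst (frame a b c d)) * Re (snd (frame a b c d))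
      + Im (fst (frame a b c d)) * Im (snd (frame a b c d))
      = (2 * c * d * (a * c + b * d) + (d\<^sup>2 - c\<^sup>2)) / N\<^sup>2"
    unfolding u z by (simp add: power2_eq_square flip: add_divide_distrib)
  show ?thesis
  proof (cases j)
    case Left_Line
    have "2 * c * d = 2 * (c * (c + a)) * N"
      using det zero unfolding Left_Line side_form.simps N_def by algebra
    then show ?thesis using N by (simp add: Left_Line u divide_simps)
  next
    case Right_Line
    have "- (2 * c * d) = 2 * (c * (c - a)) * N"
      using det zero unfolding Right_Line side_form.simps N_def by algebra
    then show ?thesis using N by (simp add: Right_Line u divide_simps)
  next
    case Left_Arc
    have "2 * (2 * c * d * (a * c + b * d) + (d\<^sup>2 - c\<^sup>2)) + 2 * c * d * N = 2 * (a * (a + c)) * N\<^sup>2"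
      using det zero unfolding Left_Arc side_form.simps N_def by algebra
    moreover have "2 * ((2 * c * d * (a * c + b * d) + (d\<^sup>2 - c\<^sup>2)) / N\<^sup>2) + 2 * c * d / N = (2 * (2 * c * d * (a * c + b * d) + (d\<^sup>2 - c\<^sup>2)) + 2 * c * d * N) / N\<^sup>2"
      using N by (simp add: add_divide_distrib diff_divide_distrib power2_eq_square)
    ultimately have "2 * ((2 * c * d * (a * c + b * d) + (d\<^sup>2 - c\<^sup>2)) / N\<^sup>2) + 2 * c * d / N = 2 * (a * (a + c))"
      using N by simp
    then show ?thesis unfolding Left_Arc side_slope.simps inner side_form.simps by (simp add: u)
  next
    case Right_Arc
    have "2 * (2 * c * d * (a * c + b * d) + (d\<^sup>2 - c\<^sup>2)) - 2 * c * d * N = 2 * (a * (a - c)) * N\<^sup>2"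
      using det zero unfolding Right_Arc side_form.simps N_def by algebra
    moreover have "2 * ((2 * c * d * (a * c + b * d) + (d\<^sup>2 - c\<^sup>2)) / N\<^sup>2) - 2 * c * d / N = (2 * (2 * c * d * (a * c + b * d) + (d\<^sup>2 - c\<^sup>2)) - 2 * c * d * N) / N\<^sup>2"
      using N by (simp add: add_divide_distrib diff_divide_distrib power2_eq_square)
    ultimately have "2 * ((2 * c * d * (a * c + b * d) + (d\<^sup>2 - c\<^sup>2)) / N\<^sup>2) - 2 * c * d / N = 2 * (a * (a - c))"
      using N by simp
    then show ?thesis unfolding Right_Arc side_slope.simps inner side_form.simps by (simp add: u)
  qed
qed

lemma side_frame_cases:
  assumes "v \<in> T1H" "side_fun j (fst v) = 0"
  obtains a b c d where "v = frame a b c d" "a * d - b * c = 1"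
    "side_form j b d = - side_form j a c"
    "side_slope j (fst v) (snd v) = 2 * side_form j a c"
    "\<And>k. k \<noteq> j \<Longrightarrow> side_form k a c + side_form k b d > 0"
proof -
  from assms(1) obtain a b c d where v: "a * d - b * c = 1" "v = frame a b c d"
    by (elim frame_exists)
  have N: "c\<^sup>2 + d\<^sup>2 > 0" using frame_norm_pos[OF v(1)] .
  have zero: "side_form j a c + side_form j b d = 0"
    using assms(2) N unfolding v(2) side_fun_frame[OF v(1)] by (metis divide_eq_0_iff less_irrefl)
  have y: "Im (fst v) > 0" using assms(1) by (auto simp: T1H_def upper_half_plane_def)
  show thesis
  proof
    show "side_form j b d = - side_form j a c" using zero by simp
    show "side_slope j (fst v) (snd v) = 2 * side_form j a c"
      unfolding v(2) by (rule side_slope_frame[OF v(1) zero])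
    show "side_form k a c + side_form k b d > 0" if "k \<noteq> j" for k
      using side_fun_pos_if_zero[OF y assms(2) that] N
      by (simp add: v(2) side_fun_frame[OF v(1)] zero_less_divide_iff)
  qed (fact v)+
qed

lemma geodesic_flow_side_fun:
  assumes "a * d - b * c = 1"
  obtains N where "N > 0"
    "\<And>k. side_fun k (fst (geodesic_flow t (frame a b c d))) =
       (exp t * side_form k a c + exp (- t) * side_form k b d) / N"
proof -
  note det = flow_det[OF assms, of t]
  have e: "(exp (t / 2))\<^sup>2 = exp t" "(exp (- (t / 2)))\<^sup>2 = exp (- t)"
    using exp_half_square[of t] exp_half_square[of "- t"] by simp_all
  show thesis
    by (rule that[OF frame_norm_pos[OF det]])
      (simp only: geodesic_flow_frame[OF assms] side_fun_frame[OF det] side_form_scale e)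
qed

lemma exp_combination_pos:
  fixes P Q t :: real
  assumes "P \<ge> 0" "P + Q \<ge> 0" "P > 0 \<or> P + Q > 0" "t > 0"
  shows "exp t * P + exp (- t) * Q > 0"
proof -
  have "exp t * P + exp (- t) * Q = (exp t - exp (- t)) * P + exp (- t) * (P + Q)"
    by (simp add: algebra_simps)
  moreover have "exp t - exp (- t) > 0" using assms(4) by simp
  ultimately show ?thesis
    using assms by (auto intro: add_pos_nonneg add_nonneg_pos)
qed

lemma inward_flow_stays_closed:
  assumes "v \<in> inward_vectors"
  shows "\<forall>\<^sub>F t in at_right 0. \<forall>k. side_fun k (fst (geodesic_flow t v)) \<ge> 0"
    and "enters j v \<Longrightarrow> \<forall>\<^sub>F t in at_right 0. fst (geodesic_flow t v) \<in> fundamental_domain"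
proof -
  have other: "\<forall>\<^sub>F t in at_right 0. exp t * P + exp (- t) * Q > 0" if "P + Q > 0" for P Q :: real
  proof -
    have "((\<lambda>t. exp t * P + exp (- t) * Q) \<longlongrightarrow> P + Q) (at_right 0)"
      by (auto intro!: tendsto_eq_intros)
    then show ?thesis using order_tendstoD(1) that by blast
  qed
  from assms obtain i where i: "enters i v \<or> grazes i v"
    by (auto simp: inward_vectors_iff)
  then have vi: "v \<in> T1H" "side_fun i (fst v) = 0" by (auto simp: enters_def grazes_def)
  then obtain a b c d where v: "v = frame a b c d" "a * d - b * c = 1"
    and i0: "side_form i b d = - side_form i a c"
    and slope: "side_slope i (fst v) (snd v) = 2 * side_form i a c"
    and pos: "\<And>k. k \<noteq> i \<Longrightarrow> side_form k a c + side_form k b d > 0"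
    by (rule side_frame_cases) (rule that)
  have nonneg: "side_form i a c \<ge> 0" using i slope by (auto simp: enters_def grazes_def)
  have "\<forall>\<^sub>F t in at_right 0. side_fun k (fst (geodesic_flow t v)) \<ge> 0" for k
  proof (cases "k = i")
    case True
    show ?thesis
    proof (rule eventually_mono[OF eventually_at_right_less])
      fix t :: real assume "0 < t"
      obtain N where "N > 0" "side_fun k (fst (geodesic_flow t v)) =
          (exp t * side_form k a c + exp (- t) * side_form k b d) / N"
        using geodesic_flow_side_fun[OF v(2)] v(1) by metis
      moreover have "exp t * side_form i a c \<ge> exp (- t) * side_form i a c"
        using nonneg \<open>0 < t\<close> by (intro mult_right_mono) simp_all
      ultimately show "side_fun k (fst (geodesic_flow t v)) \<ge> 0"
        by (simp add: True i0)
    qed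
  next
    case False
    show ?thesis
    proof (rule eventually_mono[OF other[OF pos[OF False]]])
      fix t :: real assume "exp t * side_form k a c + exp (- t) * side_form k b d > 0"
      moreover obtain N where "N > 0" "side_fun k (fst (geodesic_flow t v)) =
          (exp t * side_form k a c + exp (- t) * side_form k b d) / N"
        using geodesic_flow_side_fun[OF v(2)] v(1) by metis
      ultimately show "side_fun k (fst (geodesic_flow t v)) \<ge> 0" by simp
    qed
  qed
  then show "\<forall>\<^sub>F t in at_right 0. \<forall>k. side_fun k (fst (geodesic_flow t v)) \<ge> 0"
    by (intro eventually_all_finite) auto
  show "\<forall>\<^sub>F t in at_right 0. fst (geodesic_flow t v) \<in> fundamental_domain" if "enters j v"
  proof -
    have "i = j"
    proof (rule ccontr)
      assume "i \<noteq> j"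
      then have "side_fun j (fst v) > 0"
        using side_fun_pos_if_zero[of "fst v" i j] \<open>v \<in> T1H\<close> \<open>side_fun i (fst v) = 0\<close>
        by (auto simp: T1H_def upper_half_plane_def)
      with that show False by (simp add: enters_def)
    qed
    then have jpos: "side_form i a c > 0" using that slope by (simp add: enters_def)
    have "\<forall>\<^sub>F t in at_right 0. exp t * side_form k a c + exp (- t) * side_form k b d > 0" for k
    proof (cases "k = i")
      case True
      then show ?thesis using jpos i0
        by (auto intro!: eventually_mono[OF eventually_at_right_less] exp_combination_pos)
    qed (use other pos in blast)
    then have "\<forall>\<^sub>F t in at_right 0. \<forall>k. exp t * side_form k a c + exp (- t) * side_form k b d > 0"
      by (intro eventually_all_finite) auto
    then show ?thesis
    proof (rule eventually_mono)
      fix t assume *: "\<forall>k. exp t * side_form k a c + exp (- t) * side_form k b d > 0"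
      obtain N where N: "N > 0" "\<And>k. side_fun k (fst (geodesic_flow t v)) =
          (exp t * side_form k a c + exp (- t) * side_form k b d) / N"
        using geodesic_flow_side_fun[OF v(2)] v(1) by metis
      have "Im (fst (geodesic_flow t v)) > 0"
        using geodesic_flow_in_T1H[OF \<open>v \<in> T1H\<close>, of t] by (auto simp: T1H_def upper_half_plane_def)
      with * N show "fst (geodesic_flow t v) \<in> fundamental_domain"
        by (simp add: fundamental_domain_iff)
    qed
  qed
qed

text \<open>
  A transversal inward vector moves into the open domain at once, whereas another inward vector of
  its orbit stays in the closure for a short time. At such a time the two are related by an
  element of the group that carries an interior point into the closure.
\<close>

lemma enters_unique_lift:
  assumes "enters j v" "w \<in> inward_vectors" "dpi w = dpi v"
  shows "w = v"
proof -
  have vT: "v \<in> T1H" using assms(1) by (simp add: enters_def)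
  have wT: "w \<in> T1H" using assms(2) by (auto simp: inward_vectors_def)
  have v: "v \<in> inward_vectors" using assms(1) inward_vectors_iff by blast
  obtain g where g: "g \<in> Gamma2" "w = tangent_map g v"
    using assms(3) dpi_eq_iff[OF vT wT] by auto
  have "\<forall>\<^sub>F t in at_right 0. fst (geodesic_flow t v) \<in> fundamental_domain \<and>
      (\<forall>k. side_fun k (fst (geodesic_flow t w)) \<ge> 0)"
    using inward_flow_stays_closed(2)[OF v assms(1)] inward_flow_stays_closed(1)[OF assms(2)]
    by (rule eventually_conj)
  then obtain t where t: "fst (geodesic_flow t v) \<in> fundamental_domain"
      "\<And>k. side_fun k (fst (geodesic_flow t w)) \<ge> 0"
    using eventually_happens[of _ "at_right (0::real)"] by auto
  note flow = geodesic_flow_tangent_map[OF g(1) vT]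
  have "tangent_map g (geodesic_flow t v) = geodesic_flow t v"
    using t by (intro Gamma2_fundamental geodesic_flow_in_T1H vT g) (simp_all add: g(2) flow)
  then have "geodesic_flow t w = geodesic_flow t v" by (simp add: g(2) flow)
  moreover have "geodesic_flow (- t) (geodesic_flow t x) = x" if "x \<in> T1H" for x
  proof -
    from that obtain a b c d where x: "a * d - b * c = 1" "x = frame a b c d"
      by (elim frame_exists)
    from geodesic_flow_frame[OF flow_det[OF x(1), of t], of "- t"] show ?thesis
      unfolding x(2) geodesic_flow_frame[OF x(1)] by (simp add: mult.assoc flip: exp_add)
  qed
  ultimately show ?thesis using vT wT by metis
qed

section \<open>Side pairings\<close>

fun partner :: "side \<Rightarrow> side" where
  "partner Left_Line = Right_Line"
| "partner Right_Line = Left_Line"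
| "partner Left_Arc = Right_Arc"
| "partner Right_Arc = Left_Arc"

text \<open>
  The two generators of the group and their inverses; each one carries its side to the partner side
  and the domain to the far side of the partner.
\<close>

fun pairing :: "side \<Rightarrow> complex \<Rightarrow> complex" where
  "pairing Left_Line = moebius 1 2 0 1"
| "pairing Right_Line = moebius 1 (-2) 0 1"
| "pairing Left_Arc = moebius 1 0 2 1"
| "pairing Right_Arc = moebius 1 0 (-2) 1"

text \<open>
  The linear action of \<open>pairing\<close> on a column \<open>(r, s)\<close> of a frame.
\<close>

fun pair_top :: "side \<Rightarrow> real \<Rightarrow> real \<Rightarrow> real" where
  "pair_top Left_Line r s = r + 2 * s"
| "pair_top Right_Line r s = r - 2 * s"
| "pair_top Left_Arc r s = r"
| "pair_top Right_Arc r s = r"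

fun pair_bot :: "side \<Rightarrow> real \<Rightarrow> real \<Rightarrow> real" where
  "pair_bot Left_Line r s = s"
| "pair_bot Right_Line r s = s"
| "pair_bot Left_Arc r s = s + 2 * r"
| "pair_bot Right_Arc r s = s - 2 * r"

lemma pairing_in_Gamma2: "pairing j \<in> Gamma2"
  by (cases j)
    (use Gamma2I[of 1 1 2 0] Gamma2I[of 1 1 "-2" 0] Gamma2I[of 1 1 0 2] Gamma2I[of 1 1 0 "-2"]
      in simp_all)

lemma tangent_map_pairing:
  assumes "a * d - b * c = 1"
  shows "tangent_map (pairing j) (frame a b c d)
    = frame (pair_top j a c) (pair_top j b d) (pair_bot j a c) (pair_bot j b d)"
    and "pair_top j a c * pair_bot j b d - pair_top j b d * pair_bot j a c = 1"
proof -
  show "tangent_map (pairing j) (frame a b c d)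
    = frame (pair_top j a c) (pair_top j b d) (pair_bot j a c) (pair_bot j b d)"
    using tangent_map_frame[of 1 1 2 0, OF _ assms] tangent_map_frame[of 1 1 "-2" 0, OF _ assms]
      tangent_map_frame[of 1 1 0 2, OF _ assms] tangent_map_frame[of 1 1 0 "-2", OF _ assms]
    by (cases j) (simp_all add: add.commute)
  show "pair_top j a c * pair_bot j b d - pair_top j b d * pair_bot j a c = 1"
    using assms by (cases j) (simp_all add: algebra_simps)
qed

lemma tangent_map_pairing_partner:
  assumes "v \<in> T1H"
  shows "tangent_map (pairing (partner j)) (tangent_map (pairing j) v) = v"
proof -
  from assms obtain a b c d where v: "a * d - b * c = 1" "v = frame a b c d"
    by (elim frame_exists)
  show ?thesis
    unfolding v(2) tangent_map_pairing(1)[OF v(1)] tangent_map_pairing(1)[OF tangent_map_pairing(2)[OF v(1)]]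
    by (cases j) simp_all
qed

lemma side_form_pairing:
  "side_form (partner j) (pair_top j r s) (pair_bot j r s) = - side_form j r s"
  by (cases j) (simp_all add: algebra_simps)

lemma side_fun_pairing:
  assumes "v \<in> T1H"
  shows "sgn (side_fun (partner j) (fst (tangent_map (pairing j) v))) = - sgn (side_fun j (fst v))"
proof -
  from assms obtain a b c d where v: "a * d - b * c = 1" "v = frame a b c d"
    by (elim frame_exists)
  note det = tangent_map_pairing(2)[OF v(1), of j]
  have neg: "side_form (partner j) (pair_top j a c) (pair_bot j a c)
      + side_form (partner j) (pair_top j b d) (pair_bot j b d)
      = - (side_form j a c + side_form j b d)"
    by (simp add: side_form_pairing)
  show ?thesis
    unfolding v(2) tangent_map_pairing(1)[OF v(1)] side_fun_frame[OF det] side_fun_frame[OF v(1)]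
      neg sgn_divide sgn_minus sgn_pos[OF frame_norm_pos[OF det]] sgn_pos[OF frame_norm_pos[OF v(1)]]
    by simp
qed

section \<open>The coordinate on the quadrant\<close>

text \<open>
  With \<open>\<beta> = r / s\<close> this is \<open>(2 \<bar>\<beta>\<bar>, \<bar>\<beta>\<^sup>2 - 1\<bar>) / (\<beta>\<^sup>2 + 1)\<close>, the rational parametrisation of the
  circle folded into the closed quadrant. Folding identifies \<open>\<beta>\<close> with \<open>- \<beta>\<close> and \<open>1 / \<beta>\<close>. The
  group generated by these two reflections permutes the four sides simply transitively and
  respects the side pairings.
\<close>

definition quadrant_point :: "real \<Rightarrow> real \<Rightarrow> real \<times> real" where
  "quadrant_point r s = (2 * \<bar>r * s\<bar> / (r\<^sup>2 + s\<^sup>2), \<bar>r\<^sup>2 - s\<^sup>2\<bar> / (r\<^sup>2 + s\<^sup>2))"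

lemma quadrant_point_symmetries:
  "quadrant_point (- r) s = quadrant_point r s"
  "quadrant_point s r = quadrant_point r s"
  by (simp_all add: quadrant_point_def abs_mult add.commute mult.commute abs_minus_commute)

lemma quadrant_point_scale:
  assumes "e \<noteq> 0"
  shows "quadrant_point (r * e) (s * e) = quadrant_point r s"
proof -
  have "r * e * (s * e) = e\<^sup>2 * (r * s)" "(r * e)\<^sup>2 + (s * e)\<^sup>2 = e\<^sup>2 * (r\<^sup>2 + s\<^sup>2)"
    "(r * e)\<^sup>2 - (s * e)\<^sup>2 = e\<^sup>2 * (r\<^sup>2 - s\<^sup>2)"
    by (simp_all add: algebra_simps power2_eq_square)
  then show ?thesis using assms
    unfolding quadrant_point_def by (simp only: abs_mult) simp
qed

lemma quadrant_point_in_quadrant_iff: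
  assumes "r \<noteq> 0 \<or> s \<noteq> 0"
  shows "quadrant_point r s \<in> quadrant \<longleftrightarrow> r \<noteq> 0 \<and> s \<noteq> 0 \<and> r\<^sup>2 \<noteq> s\<^sup>2"
proof -
  define N where "N = r\<^sup>2 + s\<^sup>2"
  have N: "N > 0" using assms by (simp add: N_def sum_power2_gt_zero_iff)
  have "(2 * \<bar>r * s\<bar>)\<^sup>2 + \<bar>r\<^sup>2 - s\<^sup>2\<bar>\<^sup>2 = N\<^sup>2"
    by (simp add: N_def power_mult_distrib power2_abs) (simp add: algebra_simps power2_eq_square)
  then have "(2 * \<bar>r * s\<bar> / N)\<^sup>2 + (\<bar>r\<^sup>2 - s\<^sup>2\<bar> / N)\<^sup>2 = 1"
    using N by (simp add: power_divide flip: add_divide_distrib)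
  then show ?thesis using N
    unfolding quadrant_point_def quadrant_def N_def[symmetric]
    by (auto simp: zero_less_divide_iff)
qed

text \<open>
  In the coordinate \<open>\<beta> = r / s\<close> the map on the quadrant is the translation \<open>\<beta> \<mapsto> \<beta> - 2\<close>: with
  \<open>N = r\<^sup>2 + s\<^sup>2\<close>, its denominator is \<open>((r - 2 s)\<^sup>2 + s\<^sup>2) / N\<close> and its numerators are \<open>2 (r - 2 s) s / N\<close>
  and \<open>((r - 2 s)\<^sup>2 - s\<^sup>2) / N\<close> up to sign. The hypothesis says \<open>\<beta> > 1\<close>.
\<close>

lemma quadrant_map_quadrant_point_step:
  assumes "s * (r - s) > 0"
  shows "quadrant_map (quadrant_point r s) = quadrant_point (r - 2 * s) s"
    and "quadrant_point r s \<in> quadrant"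
proof -
  have s: "s \<noteq> 0" using assms by auto
  have "r * s = s * (r - s) + s\<^sup>2" by (simp add: algebra_simps power2_eq_square)
  then have rs: "r * s > 0" using assms by (simp add: add_pos_nonneg)
  have "r\<^sup>2 - s\<^sup>2 = (r - s)\<^sup>2 + 2 * (s * (r - s))" by (simp add: algebra_simps power2_eq_square)
  then have sq: "r\<^sup>2 - s\<^sup>2 > 0" using assms by (simp add: add_nonneg_pos)
  show "quadrant_point r s \<in> quadrant"
    using s rs sq by (subst quadrant_point_in_quadrant_iff) auto
  define N M where "N = r\<^sup>2 + s\<^sup>2" and "M = (r - 2 * s)\<^sup>2 + s\<^sup>2"
  have N: "N > 0" and M: "M > 0" using s by (simp_all add: N_def M_def add_nonneg_pos)
  have "3 * N - 2 * (2 * (r * s)) - 2 * (r\<^sup>2 - s\<^sup>2) = M"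
    "2 * N - 2 * (r * s) - 2 * (r\<^sup>2 - s\<^sup>2) = - 2 * ((r - 2 * s) * s)"
    "2 * N - 2 * (2 * (r * s)) - (r\<^sup>2 - s\<^sup>2) = (r - 2 * s)\<^sup>2 - s\<^sup>2"
    by (simp_all add: N_def M_def algebra_simps power2_eq_square)
  moreover have "3 - 2 * (2 * X / N) - 2 * (Y / N) = (3 * N - 2 * (2 * X) - 2 * Y) / N"
    "2 - 2 * X / N - 2 * (Y / N) = (2 * N - 2 * X - 2 * Y) / N"
    "2 - 2 * (2 * X / N) - Y / N = (2 * N - 2 * (2 * X) - Y) / N" for X Y
    using N by (simp_all add: diff_divide_distrib)
  ultimately have "3 - 2 * (2 * (r * s) / N) - 2 * ((r\<^sup>2 - s\<^sup>2) / N) = M / N"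
    "2 - 2 * (r * s) / N - 2 * ((r\<^sup>2 - s\<^sup>2) / N) = - 2 * ((r - 2 * s) * s) / N"
    "2 - 2 * (2 * (r * s) / N) - (r\<^sup>2 - s\<^sup>2) / N = ((r - 2 * s)\<^sup>2 - s\<^sup>2) / N"
    by (simp_all only:)
  moreover have "quadrant_point r s = (2 * (r * s) / N, (r\<^sup>2 - s\<^sup>2) / N)"
    using rs sq by (simp add: quadrant_point_def N_def)
  moreover have "\<bar>- 2 * ((r - 2 * s) * s) / N\<bar> / (M / N) = 2 * \<bar>(r - 2 * s) * s\<bar> / M"
    "\<bar>((r - 2 * s)\<^sup>2 - s\<^sup>2) / N\<bar> / (M / N) = \<bar>(r - 2 * s)\<^sup>2 - s\<^sup>2\<bar> / M"
    using N by (simp_all add: abs_mult)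
  ultimately show "quadrant_map (quadrant_point r s) = quadrant_point (r - 2 * s) s"
    unfolding quadrant_map_def quadrant_point_def[of "r - 2 * s"] M_def[symmetric]
    by (simp only: prod.case)
qed

text \<open>
  On every side the inverse of the side pairing acts as \<open>\<beta> \<mapsto> \<beta> - 2\<close>, once the side is moved to
  the left line by one of the symmetries of \<open>quadrant_point\<close>. So applying the quadrant map undoes
  the pairing.
\<close>

lemma quadrant_map_pairing:
  assumes "side_form j r s > 0"
  shows "quadrant_map (quadrant_point (pair_top j r s) (pair_bot j r s)) = quadrant_point r s"
    and "quadrant_point (pair_top j r s) (pair_bot j r s) \<in> quadrant"
proof -
  have "quadrant_map (quadrant_point (pair_top j r s) (pair_bot j r s)) = quadrant_point r s
      \<and> quadrant_point (pair_top j r s) (pair_bot j r s) \<in> quadrant"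
  proof (cases j)
    case Left_Line
    then show ?thesis
      using assms quadrant_map_quadrant_point_step[of s "r + 2 * s"] by (simp add: add.commute)
  next
    case Right_Line
    then show ?thesis
      using assms quadrant_map_quadrant_point_step[of s "2 * s - r"]
        quadrant_point_symmetries(1)[of "r - 2 * s" s] quadrant_point_symmetries(1)[of r s]
      by (simp add: algebra_simps)
  next
    case Left_Arc
    then show ?thesis
      using assms quadrant_map_quadrant_point_step[of r "s + 2 * r"]
        quadrant_point_symmetries(2)[of "s + 2 * r" r] quadrant_point_symmetries(2)[of s r]
      by (simp add: algebra_simps)
  next
    case Right_Arc
    then show ?thesis
      using assms quadrant_map_quadrant_point_step[of r "2 * r - s"]
        quadrant_point_symmetries(2)[of "s - 2 * r" r] quadrant_point_symmetries(1)[of "s - 2 * r" r]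
        quadrant_point_symmetries(2)[of s r] quadrant_point_symmetries(1)[of s r]
      by (simp add: algebra_simps)
  qed
  then show "quadrant_map (quadrant_point (pair_top j r s) (pair_bot j r s)) = quadrant_point r s"
    and "quadrant_point (pair_top j r s) (pair_bot j r s) \<in> quadrant" by blast+
qed

text \<open>
  The forward endpoint lies behind at most one side. The sum of two different forms is a sum of
  squares.
\<close>

lemma side_form_pos_if_other_neg:
  assumes "side_form k r s < 0" "l \<noteq> k"
  shows "side_form l r s > 0"
proof -
  have "s * (s + r) + s * (s - r) = 2 * s\<^sup>2" "r * (r + s) + r * (r - s) = 2 * r\<^sup>2"
    "s * (s + r) + r * (r - s) = r\<^sup>2 + s\<^sup>2" "s * (s - r) + r * (r + s) = r\<^sup>2 + s\<^sup>2"
    "s * (s + r) + r * (r + s) = (r + s)\<^sup>2" "s * (s - r) + r * (r - s) = (s - r)\<^sup>2"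
    by (simp_all add: algebra_simps power2_eq_square)
  then have "s * (s + r) + s * (s - r) \<ge> 0" "r * (r + s) + r * (r - s) \<ge> 0"
    "s * (s + r) + r * (r - s) \<ge> 0" "s * (s - r) + r * (r + s) \<ge> 0"
    "s * (s + r) + r * (r + s) \<ge> 0" "s * (s - r) + r * (r - s) \<ge> 0"
    by (simp_all only: zero_le_power2 add_nonneg_nonneg mult_nonneg_nonneg zero_le_numeral)
  then have "side_form k r s + side_form l r s \<ge> 0"
    using assms(2) by (cases k; cases l) (simp_all only: side_form.simps add.commute simp_thms)
  then show ?thesis using assms(1) by linarith
qed

lemma quadrant_point_in_quadrant_iff_side_form:
  assumes "r \<noteq> 0 \<or> s \<noteq> 0"
  shows "quadrant_point r s \<in> quadrant \<longleftrightarrow> (\<exists>k. side_form k r s < 0)"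
proof -
  have "(\<exists>k. side_form k r s < 0) \<longleftrightarrow> s * (s + r) < 0 \<or> s * (s - r) < 0 \<or> r * (r + s) < 0 \<or> r * (r - s) < 0"
    by (simp add: ex_side_iff)
  also have "\<dots> \<longleftrightarrow> r \<noteq> 0 \<and> s \<noteq> 0 \<and> \<bar>r\<bar> \<noteq> \<bar>s\<bar>"
    using assms by (auto simp: mult_less_0_iff abs_if)
  also have "\<dots> \<longleftrightarrow> quadrant_point r s \<in> quadrant"
    unfolding quadrant_point_in_quadrant_iff[OF assms] by (auto simp: abs_eq_iff power2_eq_iff)
  finally show ?thesis by blast
qed

text \<open>
  The entries \<open>p\<^sup>2\<close>, \<open>p q\<close>, \<open>q\<^sup>2\<close> for homogeneous coordinates \<open>(p, q)\<close> of the forward endpoint,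
  up to a common positive factor. They are polynomials in the position and the direction, so they are
  continuous also where the endpoint is \<open>\<infinity>\<close>.
\<close>

definition endpoint_moment :: "tangent \<Rightarrow> real \<times> real \<times> real" where
  "endpoint_moment v =
    ((cmod (fst v))\<^sup>2 + 2 * Re (fst v) * Im (fst v) * Re (snd v)
       - ((Re (fst v))\<^sup>2 - (Im (fst v))\<^sup>2) * Im (snd v),
     Re (fst v) * (1 - Im (snd v)) + Im (fst v) * Re (snd v),
     1 - Im (snd v))"

definition endpoint_value :: "tangent \<Rightarrow> real \<times> real" where
  "endpoint_value v = (case endpoint_moment v of
     (p, q, r) \<Rightarrow> (2 * \<bar>q\<bar> / (p + r), \<bar>p - r\<bar> / (p + r)))"

lemma endpoint_moment_frame:
  assumes det: "a * d - b * c = 1"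
  shows "endpoint_moment (frame a b c d)
    = (2 * a\<^sup>2 / (c\<^sup>2 + d\<^sup>2), 2 * (a * c) / (c\<^sup>2 + d\<^sup>2), 2 * c\<^sup>2 / (c\<^sup>2 + d\<^sup>2))"
proof -
  let ?v = "frame a b c d"
  define N where "N = c\<^sup>2 + d\<^sup>2"
  have N: "N > 0" using frame_norm_pos[OF det] by (simp add: N_def)
  note u = direction_frame[OF det, folded N_def]
    and z = Re_frame[of a b c d, folded N_def] Im_frame[OF det, folded N_def]
    and m = cmod_frame[OF det, folded N_def]
  define X where "X = a * c + b * d"
  have r: "1 - Im (snd ?v) = 2 * c\<^sup>2 / N"
    using N unfolding u by (simp add: field_simps) (simp add: N_def)
  have q: "Re (fst ?v) * (2 * c\<^sup>2 / N) + Im (fst ?v) * Re (snd ?v) = 2 * (a * c) / N"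
  proof -
    have "X * (2 * c\<^sup>2) + 2 * c * d = 2 * (a * c) * N"
      using det unfolding N_def X_def by algebra
    moreover have "Re (fst ?v) * (2 * c\<^sup>2 / N) + Im (fst ?v) * Re (snd ?v)
        = (X * (2 * c\<^sup>2) + 2 * c * d) / N\<^sup>2"
      unfolding u z X_def[symmetric] by (simp add: power2_eq_square add_divide_distrib)
    ultimately show ?thesis using N by (simp add: power2_eq_square)
  qed
  have p: "(cmod (fst ?v))\<^sup>2 + 2 * Re (fst ?v) * Im (fst ?v) * Re (snd ?v)
      - ((Re (fst ?v))\<^sup>2 - (Im (fst ?v))\<^sup>2) * Im (snd ?v) = 2 * a\<^sup>2 / N"
  proof -
    have "(a\<^sup>2 + b\<^sup>2) * N\<^sup>2 + 2 * X * (2 * c * d) - (X\<^sup>2 - 1) * (d\<^sup>2 - c\<^sup>2)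
        = 2 * a\<^sup>2 * N\<^sup>2"
      using det unfolding N_def X_def by algebra
    moreover have "(cmod (fst ?v))\<^sup>2 + 2 * Re (fst ?v) * Im (fst ?v) * Re (snd ?v)
        - ((Re (fst ?v))\<^sup>2 - (Im (fst ?v))\<^sup>2) * Im (snd ?v)
      = ((a\<^sup>2 + b\<^sup>2) * N\<^sup>2 + 2 * X * (2 * c * d)
         - (X\<^sup>2 - 1) * (d\<^sup>2 - c\<^sup>2)) / N ^ 3"
      using N unfolding u z X_def[symmetric] m
      by (simp add: power_divide) (simp add: field_simps power2_eq_square power3_eq_cube)
    ultimately show ?thesis using N by (simp add: power2_eq_square power3_eq_cube)
  qed
  show ?thesis unfolding endpoint_moment_def r q p N_def[symmetric] by simp
qed

lemma endpoint_value_frame: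
  assumes det: "a * d - b * c = 1"
  shows "endpoint_value (frame a b c d) = quadrant_point a c"
proof -
  define N where "N = c\<^sup>2 + d\<^sup>2"
  have N: "N > 0" using frame_norm_pos[OF det] by (simp add: N_def)
  have "2 * \<bar>2 * (a * c) / N\<bar> / (2 * a\<^sup>2 / N + 2 * c\<^sup>2 / N) = 2 * \<bar>a * c\<bar> / (a\<^sup>2 + c\<^sup>2)"
    "\<bar>2 * a\<^sup>2 / N - 2 * c\<^sup>2 / N\<bar> / (2 * a\<^sup>2 / N + 2 * c\<^sup>2 / N) = \<bar>a\<^sup>2 - c\<^sup>2\<bar> / (a\<^sup>2 + c\<^sup>2)"
  proof -
    have cancel: "2 * \<bar>k * x\<bar> / (k * S) = 2 * \<bar>x\<bar> / S" "\<bar>k * x\<bar> / (k * S) = \<bar>x\<bar> / S"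
      if "k > 0" for k x S :: real
      using that by (simp_all add: abs_mult)
    have e: "2 * a\<^sup>2 / N + 2 * c\<^sup>2 / N = (2 / N) * (a\<^sup>2 + c\<^sup>2)"
      "2 * a\<^sup>2 / N - 2 * c\<^sup>2 / N = (2 / N) * (a\<^sup>2 - c\<^sup>2)" "2 * (a * c) / N = (2 / N) * (a * c)"
      by (simp_all add: add_divide_distrib diff_divide_distrib distrib_left right_diff_distrib)
    show "2 * \<bar>2 * (a * c) / N\<bar> / (2 * a\<^sup>2 / N + 2 * c\<^sup>2 / N) = 2 * \<bar>a * c\<bar> / (a\<^sup>2 + c\<^sup>2)"
      "\<bar>2 * a\<^sup>2 / N - 2 * c\<^sup>2 / N\<bar> / (2 * a\<^sup>2 / N + 2 * c\<^sup>2 / N) = \<bar>a\<^sup>2 - c\<^sup>2\<bar> / (a\<^sup>2 + c\<^sup>2)"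
      unfolding e by (rule cancel; use N in simp)+
  qed
  then show ?thesis
    unfolding endpoint_value_def endpoint_moment_frame[OF det] N_def[symmetric] quadrant_point_def
    by simp
qed

lemma endpoint_value_flow:
  assumes "v \<in> T1H"
  shows "endpoint_value (geodesic_flow t v) = endpoint_value v"
proof -
  from assms obtain a b c d where v: "a * d - b * c = 1" "v = frame a b c d"
    by (elim frame_exists)
  show ?thesis
    unfolding v(2) geodesic_flow_frame[OF v(1)]
    by (simp add: endpoint_value_frame flow_det v(1) quadrant_point_scale)
qed

section \<open>The factor map\<close>

text \<open>
  A transversal inward vector on side \<open>j\<close> has a second lift on the boundary of the domain, its image
  under the pairing of \<open>j\<close>, which points out of the domain. The value of the factor map is the folded
  forward endpoint of this outgoing lift. An orbit that has no transversal lift gets the fixed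
  point of the quadrant map.
\<close>

definition factor_map :: "tangent set \<Rightarrow> real \<times> real" where
  "factor_map \<omega> =
     (if \<exists>j v. enters j v \<and> dpi v = \<omega>
      then (SOME e. \<exists>j v. enters j v \<and> dpi v = \<omega> \<and> e = endpoint_value (tangent_map (pairing j) v))
      else (1 / sqrt 2, 1 / sqrt 2))"

lemma enters_imp_inward: "enters j v \<Longrightarrow> v \<in> inward_vectors"
  using inward_vectors_iff by blast

lemma side_zero_unique:
  assumes "v \<in> T1H" "side_fun j (fst v) = 0" "side_fun k (fst v) = 0"
  shows "j = k"
proof (rule ccontr)
  assume "j \<noteq> k"
  moreover have "Im (fst v) > 0" using assms(1) by (auto simp: T1H_def upper_half_plane_def)
  ultimately have "side_fun k (fst v) > 0" using assms(2) by (intro side_fun_pos_if_zero[of _ j]) auto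
  with assms(3) show False by simp
qed

lemma factor_map_enters:
  assumes "enters j v"
  shows "factor_map (dpi v) = endpoint_value (tangent_map (pairing j) v)"
proof -
  have "e = endpoint_value (tangent_map (pairing j) v)"
    if "\<exists>k w. enters k w \<and> dpi w = dpi v \<and> e = endpoint_value (tangent_map (pairing k) w)" for e
  proof -
    from that obtain k w where kw: "enters k w" "dpi w = dpi v"
      "e = endpoint_value (tangent_map (pairing k) w)" by blast
    have "w = v" using enters_unique_lift[OF assms enters_imp_inward[OF kw(1)] kw(2)] .
    moreover have "k = j" using kw(1) assms side_zero_unique
      unfolding \<open>w = v\<close> enters_def by blast
    ultimately show ?thesis using kw(3) by simp
  qed
  then show ?thesis
    unfolding factor_map_def using assms by (subst if_P) (blast, intro some_equality, blast+)
qed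

lemma factor_map_grazes:
  assumes "grazes j v"
  shows "factor_map (dpi v) = (1 / sqrt 2, 1 / sqrt 2)"
proof -
  have "\<not> (enters k w \<and> dpi w = dpi v)" for k w
  proof
    assume kw: "enters k w \<and> dpi w = dpi v"
    then have "v = w"
      using enters_unique_lift[of k w v] inward_if_enters_or_grazes[of j v] assms by simp
    with kw have "enters k v" by simp
    moreover from this have "k = j"
      using assms side_zero_unique unfolding enters_def grazes_def by blast
    ultimately show False using assms by (simp add: enters_def grazes_def)
  qed
  then show ?thesis unfolding factor_map_def by (intro if_not_P) blast
qed

lemma enters_frame:
  assumes "enters j v"
  obtains a b c d where "v = frame a b c d" "a * d - b * c = 1"
    "side_form j a c > 0" "side_form j b d = - side_form j a c"
    "\<And>k. k \<noteq> j \<Longrightarrow> side_form k a c + side_form k b d > 0"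
proof -
  have v: "v \<in> T1H" "side_fun j (fst v) = 0" and slope: "side_slope j (fst v) (snd v) > 0"
    using assms by (simp_all add: enters_def)
  obtain a b c d where "v = frame a b c d" "a * d - b * c = 1"
    "side_form j b d = - side_form j a c"
    "side_slope j (fst v) (snd v) = 2 * side_form j a c"
    "\<And>k. k \<noteq> j \<Longrightarrow> side_form k a c + side_form k b d > 0"
    by (rule side_frame_cases[OF v]) (rule that)
  moreover from this slope have "side_form j a c > 0" by simp
  ultimately show thesis by (intro that)
qed

text \<open>
  The quadrant map turns the endpoint of the outgoing lift into the endpoint of the
  incoming one.
\<close>

lemma factor_map_enters_values:
  assumes "enters j v"
  shows "factor_map (dpi v) \<in> quadrant" "quadrant_map (factor_map (dpi v)) = endpoint_value v"
proof -
  obtain a b c d where v: "v = frame a b c d" "a * d - b * c = 1" "side_form j a c > 0"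
    by (rule enters_frame[OF assms])
  have "factor_map (dpi v) = quadrant_point (pair_top j a c) (pair_bot j a c)"
    using factor_map_enters[OF assms] endpoint_value_frame[OF tangent_map_pairing(2)[OF v(2), of j]]
    by (simp add: v(1) tangent_map_pairing(1)[OF v(2)])
  then show "factor_map (dpi v) \<in> quadrant" "quadrant_map (factor_map (dpi v)) = endpoint_value v"
    using quadrant_map_pairing[OF v(3)] by (simp_all add: v(1) endpoint_value_frame[OF v(2)])
qed

lemma quadrant_map_fixed_point:
  "quadrant_map (1 / sqrt 2, 1 / sqrt 2) = (1 / sqrt 2, 1 / sqrt 2)"
  "(1 / sqrt 2, 1 / sqrt 2) \<in> quadrant"
proof -
  define h where "h = 1 / sqrt 2"
  have h: "h > 0" "h\<^sup>2 = 1 / 2" by (simp_all add: h_def power_divide)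
  have hh: "h * h = 1 / 2" using h(2) by (simp add: power2_eq_square)
  have "h < 3 / 4"
  proof (rule power_less_imp_less_base[of h 2])
    show "h\<^sup>2 < (3 / 4)\<^sup>2" unfolding h(2) by (simp add: power2_eq_square)
  qed simp
  moreover have "2 / 3 < h"
  proof (rule power_less_imp_less_base[of _ 2])
    show "(2 / 3)\<^sup>2 < h\<^sup>2" unfolding h(2) by (simp add: power2_eq_square)
  qed (use h in simp)
  moreover have "h * (3 - 2 * h - 2 * h) = 3 * h - 4 * (h * h)" by (simp add: algebra_simps)
  ultimately have "\<bar>2 - h - 2 * h\<bar> / (3 - 2 * h - 2 * h) = h"
    by (subst divide_eq_eq) (simp add: hh)
  moreover have "2 - 2 * h - h = 2 - h - 2 * h" by simp
  ultimately show "quadrant_map (1 / sqrt 2, 1 / sqrt 2) = (1 / sqrt 2, 1 / sqrt 2)"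
    unfolding quadrant_map_def h_def[symmetric] prod.case by (simp only:)
  show "(1 / sqrt 2, 1 / sqrt 2) \<in> quadrant"
    using h(1) hh unfolding quadrant_def h_def[symmetric] by (simp add: power2_eq_square)
qed

section \<open>The return map\<close>

text \<open>
  An orbit with a base point in the open domain has no lift on the boundary, so no return can happen
  before the geodesic has crossed the domain.
\<close>

lemma interior_not_in_cross_section:
  assumes "w \<in> T1H" "fst w \<in> fundamental_domain"
  shows "dpi w \<notin> cross_section"
proof
  assume "dpi w \<in> cross_section"
  then obtain x where x: "x \<in> inward_vectors" "dpi w = dpi x"
    by (auto simp: cross_section_def)
  then have "x \<in> T1H" by (auto simp: inward_vectors_def)
  then obtain g where g: "g \<in> Gamma2" "x = tangent_map g w"
    using x(2) dpi_eq_iff[OF assms(1)] by blast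
  have "tangent_map g w = w"
    using side_fun_inward_nonneg[OF x(1)] by (intro Gamma2_fundamental assms g) (simp add: g)
  then show False using g(2) x(1) assms(2) inward_not_interior by metis
qed

lemma geodesic_flow_interior_iff:
  assumes "a * d - b * c = 1"
  shows "fst (geodesic_flow t (frame a b c d)) \<in> fundamental_domain \<longleftrightarrow>
    (\<forall>k. exp t * side_form k a c + exp (- t) * side_form k b d > 0)"
proof -
  obtain N where N: "N > 0" "\<And>k. side_fun k (fst (geodesic_flow t (frame a b c d))) =
       (exp t * side_form k a c + exp (- t) * side_form k b d) / N"
    using geodesic_flow_side_fun[OF assms] by metis
  have "Im (fst (geodesic_flow t (frame a b c d))) > 0"
    using geodesic_flow_in_T1H[OF frame_in_T1H[OF assms], of t]
    by (auto simp: T1H_def upper_half_plane_def)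
  then show ?thesis using N(1) by (simp add: fundamental_domain_iff N(2) zero_less_divide_iff)
qed

lemma frame_enters_or_grazes:
  assumes det: "a * d - b * c = 1" and zero: "side_form j a c + side_form j b d = 0"
  shows "side_form j a c > 0 \<Longrightarrow> enters j (frame a b c d)"
    and "side_form j a c = 0 \<Longrightarrow> side_curvature j = 1 \<Longrightarrow> grazes j (frame a b c d)"
  using frame_in_T1H[OF det] side_fun_frame[OF det, of j] side_slope_frame[OF det zero] zero
  by (simp_all add: enters_def grazes_def)

text \<open>
  If the forward endpoint lies behind side \<open>k\<close>, the geodesic leaves through \<open>k\<close> at the time
  when \<open>exp t * P + exp (- t) * Q = 0\<close>, that is \<open>exp (2 t) = - Q / P\<close>; the other side functions stay
  positive because their forms are positive at the forward endpoint. The pairing turns the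
  outgoing vector into one that enters through the partner side.
\<close>

lemma enters_exit:
  assumes v: "enters j (frame a b c d)" and det: "a * d - b * c = 1"
    and pos: "side_form j a c > 0" "side_form j b d = - side_form j a c"
      "\<And>k. k \<noteq> j \<Longrightarrow> side_form k a c + side_form k b d > 0"
    and neg: "side_form k a c < 0"
  obtains t where "t > 0"
    "\<And>s. 0 < s \<Longrightarrow> s < t \<Longrightarrow> fst (geodesic_flow s (frame a b c d)) \<in> fundamental_domain"
    "enters (partner k) (tangent_map (pairing k) (geodesic_flow t (frame a b c d)))"
proof
  define P Q where "P = side_form k a c" and "Q = side_form k b d"
  have kj: "k \<noteq> j" using pos(1) neg by auto
  have P: "P < 0" and PQ: "P + Q > 0" using neg pos(3)[OF kj] by (simp_all add: P_def Q_def)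
  define t where "t = ln (Q / - P) / 2"
  have q1: "Q / - P > 1" using P PQ by (subst pos_less_divide_eq) simp_all
  show t0: "t > 0" unfolding t_def using q1 by simp
  have e2: "exp (t + t) = Q / - P" using q1 by (simp add: t_def)
  have split: "exp s * P + exp (- s) * Q = exp (- s) * (exp (s + s) * P + Q)" for s
    by (simp add: distrib_left mult.assoc[symmetric] flip: exp_add)
  show "fst (geodesic_flow s (frame a b c d)) \<in> fundamental_domain" if s: "0 < s" "s < t" for s
    unfolding geodesic_flow_interior_iff[OF det]
  proof
    fix l
    show "exp s * side_form l a c + exp (- s) * side_form l b d > 0"
    proof (cases "l = k")
      case True
      have "exp (s + s) < Q / - P" unfolding e2[symmetric] using s by simp
      then have "exp (s + s) * P + Q > 0" using P by (simp add: field_simps)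
      then show ?thesis using split[of s] by (simp add: True flip: P_def Q_def)
    next
      case False
      then have "side_form l a c > 0" using side_form_pos_if_other_neg[OF neg] by blast
      moreover have "side_form l a c + side_form l b d \<ge> 0"
        using pos(2) pos(3)[of l] by (cases "l = j") auto
      ultimately show ?thesis using s by (intro exp_combination_pos) auto
    qed
  qed
  note fd = flow_det[OF det, of t]
  have "exp (t + t) * P + Q = 0" using P unfolding e2 by simp
  then have "exp t * P + exp (- t) * Q = 0" by (simp only: split)
  then have zero: "side_form k (a * exp (t / 2)) (c * exp (t / 2))
      + side_form k (b * exp (- (t / 2))) (d * exp (- (t / 2))) = 0"
    using exp_half_square[of "- t"] by (simp add: side_form_scale exp_half_square P_def Q_def)
  have "side_form k (a * exp (t / 2)) (c * exp (t / 2)) < 0"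
    using P by (simp add: side_form_scale P_def mult_pos_neg)
  then show "enters (partner k) (tangent_map (pairing k) (geodesic_flow t (frame a b c d)))"
    unfolding geodesic_flow_frame[OF det] tangent_map_pairing(1)[OF fd]
    by (intro frame_enters_or_grazes(1) tangent_map_pairing(2)[OF fd])
      (use zero in \<open>simp_all add: side_form_pairing\<close>)
qed

lemma return_times_eq:
  assumes "v \<in> T1H"
  shows "return_times (dpi v) = {t. t > 0 \<and> dpi (geodesic_flow t v) \<in> cross_section}"
  by (simp add: return_times_def quotient_flow_dpi[OF assms])

text \<open>
  At the return, the outgoing lift is the vector that the flow has reached, and this has the same forward
  endpoint as the incoming vector at the start. If the forward endpoint is behind no side, it is a
  cusp; then there is no return, and the folded endpoint is a corner of the closed quadrant.
\<close>

lemma factor_map_commutes_enters: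
  assumes v: "enters j v"
  shows "if return_times (dpi v) \<noteq> {}
    then first_return (dpi v) \<in> cross_section \<and>
      quadrant_map (factor_map (dpi v)) = factor_map (first_return (dpi v))
    else quadrant_map (factor_map (dpi v)) \<notin> quadrant"
proof -
  have vT: "v \<in> T1H" using v by (simp add: enters_def)
  obtain a b c d where fr: "v = frame a b c d" "a * d - b * c = 1"
    and pos: "side_form j a c > 0" "side_form j b d = - side_form j a c"
      "\<And>k. k \<noteq> j \<Longrightarrow> side_form k a c + side_form k b d > 0"
    by (rule enters_frame[OF v]) (rule that)
  show ?thesis
  proof (cases "\<exists>k. side_form k a c < 0")
    case False
    then have nn: "side_form k a c \<ge> 0" for k by (simp add: not_less)
    have "fst (geodesic_flow t v) \<in> fundamental_domain" if "t > 0" for t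
      unfolding fr(1) geodesic_flow_interior_iff[OF fr(2)]
    proof
      fix k
      have "side_form k a c + side_form k b d \<ge> 0 \<and>
          (side_form k a c > 0 \<or> side_form k a c + side_form k b d > 0)"
        using pos(1,2) pos(3)[of k] by (cases "k = j") auto
      then show "exp t * side_form k a c + exp (- t) * side_form k b d > 0"
        using nn that by (intro exp_combination_pos) auto
    qed
    then have "return_times (dpi v) = {}"
      using interior_not_in_cross_section geodesic_flow_in_T1H[OF vT]
      by (auto simp: return_times_eq[OF vT])
    moreover have "endpoint_value v \<notin> quadrant"
    proof -
      have "a \<noteq> 0 \<or> c \<noteq> 0" using fr(2) by auto
      then show ?thesis using False
        by (simp add: fr(1) endpoint_value_frame[OF fr(2)] quadrant_point_in_quadrant_iff_side_form)
    qed
    ultimately show ?thesis by (simp add: factor_map_enters_values(2)[OF v])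
  next
    case True
    then obtain k where k: "side_form k a c < 0" by blast
    obtain t where t: "t > 0"
      "\<And>s. 0 < s \<Longrightarrow> s < t \<Longrightarrow> fst (geodesic_flow s v) \<in> fundamental_domain"
      "enters (partner k) (tangent_map (pairing k) (geodesic_flow t v))"
      by (rule enters_exit[OF v[unfolded fr(1)] fr(2) pos k, folded fr(1)]) (assumption, rule that)
    let ?w = "geodesic_flow t v"
    have wT: "?w \<in> T1H" using geodesic_flow_in_T1H[OF vT] .
    have w: "dpi ?w = dpi (tangent_map (pairing k) ?w)"
      using dpi_eq_iff[OF wT tangent_map_in_T1H[OF pairing_in_Gamma2 wT]] pairing_in_Gamma2 by blast
    have wX: "dpi ?w \<in> cross_section"
      unfolding w cross_section_def using enters_imp_inward[OF t(3)] by blast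
    have "return_times (dpi v) \<noteq> {}" using wX t(1) by (auto simp: return_times_eq[OF vT])
    moreover have "Inf (return_times (dpi v)) = t"
    proof (rule cInf_eq_minimum)
      show "t \<in> return_times (dpi v)" using wX t(1) by (simp add: return_times_eq[OF vT])
      show "t \<le> s" if "s \<in> return_times (dpi v)" for s
        using that interior_not_in_cross_section[OF geodesic_flow_in_T1H[OF vT] t(2)]
        by (force simp: return_times_eq[OF vT])
    qed
    then have "first_return (dpi v) = dpi ?w"
      by (simp add: first_return_def quotient_flow_dpi[OF vT])
    moreover have "factor_map (dpi ?w) = endpoint_value v"
      unfolding w factor_map_enters[OF t(3)] tangent_map_pairing_partner[OF wT]
      by (rule endpoint_value_flow[OF vT])
    ultimately show ?thesis using wX by (simp add: factor_map_enters_values(2)[OF v])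
  qed
qed

text \<open>
  The geodesic of a vector tangent to a semicircle runs along it, and all its vectors are inward.
\<close>

lemma grazes_returns_at_once:
  assumes v: "grazes j v"
  shows "return_times (dpi v) = {0<..}" "first_return (dpi v) = dpi v"
proof -
  have vT: "v \<in> T1H" and v0: "side_fun j (fst v) = 0" and curv: "side_curvature j = 1"
    and slope: "side_slope j (fst v) (snd v) = 0"
    using v by (simp_all add: grazes_def)
  obtain a b c d where fr: "v = frame a b c d" "a * d - b * c = 1"
    and zero: "side_form j b d = - side_form j a c"
    and sl: "side_slope j (fst v) (snd v) = 2 * side_form j a c"
    by (rule side_frame_cases[OF vT v0]) (rule that)
  have "dpi (geodesic_flow t v) \<in> cross_section" for t
  proof -
    have "grazes j (geodesic_flow t v)"
      unfolding fr(1) geodesic_flow_frame[OF fr(2)]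
      by (intro frame_enters_or_grazes(2) flow_det[OF fr(2)] curv)
        (use zero sl slope in \<open>simp_all add: side_form_scale\<close>)
    then show ?thesis using inward_vectors_iff unfolding cross_section_def by blast
  qed
  then show "return_times (dpi v) = {0<..}" by (auto simp: return_times_eq[OF vT])
  moreover have "geodesic_flow 0 v = v"
    using geodesic_flow_frame[OF fr(2), of 0] by (simp add: fr(1))
  ultimately show "first_return (dpi v) = dpi v"
    by (simp add: first_return_def quotient_flow_dpi[OF vT])
qed

section \<open>Surjectivity\<close>

text \<open>
  The point \<open>(x, y)\<close> has the coordinate \<open>\<beta> = (1 + y) / x > 1\<close>. It is attained on the left line by
  the geodesic with forward endpoint \<open>\<beta> - 2\<close> and backward endpoint \<open>- \<beta>\<close>, its mirror image in the
  line; \<open>m\<close> makes the determinant \<open>1\<close>.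
\<close>

lemma factor_map_surj: "quadrant \<subseteq> factor_map ` cross_section"
proof
  fix e assume "e \<in> quadrant"
  then obtain x y where e: "e = (x, y)" "x > 0" "y > 0" "x\<^sup>2 + y\<^sup>2 = 1"
    by (auto simp: quadrant_def)
  have "x < 1"
  proof (rule power_less_imp_less_base[of x 2])
    show "x\<^sup>2 < 1\<^sup>2" using e(4) zero_less_power[OF e(3), of 2] by (simp only: one_power2)
  qed simp
  then have D: "2 * x * (1 + y - x) > 0" using e by simp
  define m where "m = 1 / sqrt (2 * x * (1 + y - x))"
  have m: "m > 0" and m2: "m\<^sup>2 * (2 * x * (1 + y - x)) = 1"
    using D by (simp_all only: m_def power_divide real_sqrt_pow2 less_imp_le) (simp, force)
  define a b c d where "a = (1 + y - 2 * x) * m" and "b = - (1 + y) * m" and "c = x * m" and "d = x * m"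
  note defs = a_def b_def c_def d_def
  have det: "a * d - b * c = 1" using m2 unfolding defs by algebra
  have form: "side_form Left_Line a c = m\<^sup>2 * (x * (1 + y - x))"
    "side_form Left_Line b d = - (m\<^sup>2 * (x * (1 + y - x)))"
    unfolding defs by (simp_all add: algebra_simps power2_eq_square)
  have enters: "enters Left_Line (frame a b c d)"
    by (rule frame_enters_or_grazes(1)[OF det]) (use m D e in \<open>simp_all only: form\<close>, simp_all)
  have N: "(1 + y)\<^sup>2 + x\<^sup>2 = 2 * (1 + y)" "(1 + y)\<^sup>2 - x\<^sup>2 = y * (2 * (1 + y))"
    using e(4) by (simp_all add: power2_eq_square algebra_simps)
  have "factor_map (dpi (frame a b c d)) = quadrant_point (pair_top Left_Line a c) (pair_bot Left_Line a c)"
    using factor_map_enters[OF enters] endpoint_value_frame[OF tangent_map_pairing(2)[OF det, of Left_Line]]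
    by (simp only: tangent_map_pairing(1)[OF det])
  also have "\<dots> = quadrant_point ((1 + y) * m) (x * m)"
    by (simp add: defs algebra_simps)
  also have "\<dots> = quadrant_point (1 + y) x" using m by (intro quadrant_point_scale) simp
  also have "\<dots> = e"
  proof -
    define w where "w = 1 + y"
    have "w > 0" using e(3) by (simp add: w_def)
    then show ?thesis
      unfolding quadrant_point_def w_def[symmetric] N[folded w_def]
      using e(2,3) by (simp add: e(1) abs_mult)
  qed
  finally show "e \<in> factor_map ` cross_section"
    using enters_imp_inward[OF enters] unfolding cross_section_def by blast
qed

section \<open>Measurability\<close>

lemma continuous_on_tangent_map:
  assumes "g \<in> Gamma2"
  shows "continuous_on T1H (tangent_map g)"
proof -
  from assms obtain a b c d :: int
    where g: "g = real_moebius (of_int a) (of_int b) (of_int c) (of_int d)" "a * d - b * c = 1"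
    by (elim Gamma2E)
  have nz: "of_real (of_int c) * fst v + of_real (of_int d) \<noteq> 0" and u: "snd v \<noteq> 0"
    and pos: "Im (fst v) > 0" if "v \<in> T1H" for v
    using that real_moebius_denom_nonzero[OF det_of_int[OF g(2)], of "fst v"]
    by (auto simp: T1H_def upper_half_plane_def)
  have "continuous_on T1H (\<lambda>v. ((of_real (of_int a) * fst v + of_real (of_int b))
      / (of_real (of_int c) * fst v + of_real (of_int d)),
      sgn (1 / (of_real (of_int c) * fst v + of_real (of_int d))\<^sup>2 * snd v)))"
    by (intro continuous_intros ballI) (simp_all add: nz u del: of_real_of_int_eq)
  moreover have "((of_real (of_int a) * fst v + of_real (of_int b))
      / (of_real (of_int c) * fst v + of_real (of_int d)),
      sgn (1 / (of_real (of_int c) * fst v + of_real (of_int d))\<^sup>2 * snd v)) = tangent_map g v"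
    if "v \<in> T1H" for v
    unfolding tangent_map_def g(1)
      DERIV_imp_deriv[OF real_moebius_has_field_derivative[OF det_of_int[OF g(2)] pos[OF that]]]
    by (simp add: moebius_def)
  ultimately show ?thesis by (rule continuous_on_eq)
qed

lemma continuous_on_endpoint_value: "continuous_on T1H endpoint_value"
proof -
  let ?p = "\<lambda>v. (cmod (fst v))\<^sup>2 + 2 * Re (fst v) * Im (fst v) * Re (snd v)
       - ((Re (fst v))\<^sup>2 - (Im (fst v))\<^sup>2) * Im (snd v)"
  let ?r = "\<lambda>v. 1 - Im (snd v)"
  have pos: "?p v + ?r v \<noteq> 0" if "v \<in> T1H" for v
  proof -
    from that obtain a b c d where v: "a * d - b * c = 1" "v = frame a b c d"
      by (elim frame_exists)
    have "c\<^sup>2 + d\<^sup>2 > 0" using frame_norm_pos[OF v(1)] .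
    moreover have "a \<noteq> 0 \<or> c \<noteq> 0" using v(1) by auto
    then have "a\<^sup>2 + c\<^sup>2 > 0" by (simp add: sum_power2_gt_zero_iff)
    ultimately have "2 * a\<^sup>2 / (c\<^sup>2 + d\<^sup>2) + 2 * c\<^sup>2 / (c\<^sup>2 + d\<^sup>2) > 0"
      by (simp flip: add_divide_distrib)
    moreover have "?p v = 2 * a\<^sup>2 / (c\<^sup>2 + d\<^sup>2)" "?r v = 2 * c\<^sup>2 / (c\<^sup>2 + d\<^sup>2)"
      using endpoint_moment_frame[OF v(1)] unfolding v(2) endpoint_moment_def by simp_all
    ultimately show ?thesis by simp
  qed
  show ?thesis
    unfolding endpoint_value_def[abs_def] endpoint_moment_def prod.case
    by (intro continuous_intros ballI pos)
qed

text \<open>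
  Base points in an open neighbourhood of side \<open>j\<close> formed by the side, the domain, and its neighbour
  across the side. The base point of a vector whose orbit is in the cross-section can only be on the
  side itself, so the open sets \<open>dpi ` collar j S\<close> of the quotient cut the preimages of the factor
  map out of the cross-section.
\<close>

definition collar :: "side \<Rightarrow> (real \<times> real) set \<Rightarrow> tangent set" where
  "collar j S = {v \<in> T1H. (\<forall>k\<in>- {j}. side_fun k (fst v) > 0) \<and>
     (\<forall>k\<in>- {partner j}. side_fun k (fst (tangent_map (pairing j) v)) > 0) \<and>
     side_slope j (fst v) (snd v) > 0 \<and> endpoint_value (tangent_map (pairing j) v) \<in> S}"

lemma open_collar:
  assumes "open S"
  shows "openin (top_of_set T1H) (collar j S)"
proof -
  let ?\<gamma> = "tangent_map (pairing j)"
  note \<gamma> = continuous_on_tangent_map[OF pairing_in_Gamma2[of j]]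
  have \<gamma>T: "?\<gamma> ` T1H \<subseteq> T1H" using tangent_map_in_T1H[OF pairing_in_Gamma2] by blast
  have preimage: "openin (top_of_set T1H) (T1H \<inter> f -` U)"
    if "continuous_on T1H f" "open U" for f :: "tangent \<Rightarrow> 'b::topological_space" and U
    using continuous_openin_preimage_gen[OF that] .
  have side: "continuous_on T1H (\<lambda>v. side_fun k (fst v))" for k
    by (rule continuous_on_compose2[OF continuous_side_fun[of UNIV k] continuous_on_fst[OF continuous_on_id]])
      simp
  have side': "continuous_on T1H (\<lambda>v. side_fun k (fst (?\<gamma> v)))" for k
    using continuous_on_compose2[OF side \<gamma> \<gamma>T] .
  have slope: "continuous_on T1H (\<lambda>v. side_slope j (fst v) (snd v))"
    by (cases j) (auto intro!: continuous_intros)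
  have val: "continuous_on T1H (\<lambda>v. endpoint_value (?\<gamma> v))"
    using continuous_on_compose2[OF continuous_on_endpoint_value \<gamma> \<gamma>T] .
  have eq: "collar j S = T1H \<inter> (\<Inter>k\<in>- {j}. T1H \<inter> (\<lambda>v. side_fun k (fst v)) -` {0<..})
    \<inter> (\<Inter>k\<in>- {partner j}. T1H \<inter> (\<lambda>v. side_fun k (fst (?\<gamma> v))) -` {0<..})
    \<inter> (T1H \<inter> (\<lambda>v. side_slope j (fst v) (snd v)) -` {0<..})
    \<inter> (T1H \<inter> (\<lambda>v. endpoint_value (?\<gamma> v)) -` S)"
    unfolding collar_def by auto
  have nonempty: "- {k} \<noteq> {}" for k :: side
    by (cases k) auto
  have sides: "openin (top_of_set T1H) (\<Inter>k\<in>- {j}. T1H \<inter> (\<lambda>v. side_fun k (fst v)) -` {0<..})"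
    "openin (top_of_set T1H) (\<Inter>k\<in>- {partner j}. T1H \<inter> (\<lambda>v. side_fun k (fst (?\<gamma> v))) -` {0<..})"
    by (intro openin_INT2 preimage side side' nonempty finite ballI open_greaterThan)+
  show ?thesis
    unfolding eq by (intro openin_Int sides preimage[OF slope open_greaterThan] preimage[OF val assms]
      openin_subtopology_self)
qed

text \<open>
  The saturation of an open set is a union of translates, so its image in the quotient is open.
\<close>

lemma dpi_image_measurable:
  assumes "openin (top_of_set T1H) G"
  shows "dpi ` G \<in> sets T1M_borel"
proof -
  have G: "G \<subseteq> T1H" using openin_imp_subset[OF assms] .
  have "{v \<in> T1H. dpi v \<in> dpi ` G} = (\<Union>g\<in>Gamma2. T1H \<inter> tangent_map g -` G)"
  proof (intro set_eqI iffI)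
    fix v assume "v \<in> {v \<in> T1H. dpi v \<in> dpi ` G}"
    then obtain w where w: "v \<in> T1H" "w \<in> G" "dpi v = dpi w" by blast
    then obtain g where "g \<in> Gamma2" "w = tangent_map g v"
      using dpi_eq_iff[of v w] G by blast
    with w show "v \<in> (\<Union>g\<in>Gamma2. T1H \<inter> tangent_map g -` G)" by blast
  next
    fix v assume "v \<in> (\<Union>g\<in>Gamma2. T1H \<inter> tangent_map g -` G)"
    then obtain g where g: "g \<in> Gamma2" "v \<in> T1H" "tangent_map g v \<in> G" by blast
    then have "dpi v = dpi (tangent_map g v)"
      using dpi_eq_iff[of v "tangent_map g v"] G by blast
    with g show "v \<in> {v \<in> T1H. dpi v \<in> dpi ` G}" by auto
  qed
  moreover have "openin (top_of_set T1H) (T1H \<inter> tangent_map g -` G)" if "g \<in> Gamma2" for g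
    using continuous_on_tangent_map[OF that] tangent_map_in_T1H[OF that] assms
    by (intro continuous_openin_preimage) auto
  then have "openin (top_of_set T1H) (\<Union>g\<in>Gamma2. T1H \<inter> tangent_map g -` G)"
    by (intro openin_Union) blast
  ultimately have "openin (top_of_set T1H) {v \<in> T1H. dpi v \<in> dpi ` G}" by (simp only:)
  then have "dpi ` G \<in> {U. U \<subseteq> T1M \<and> openin (top_of_set T1H) {v \<in> T1H. dpi v \<in> U}}"
    using G by (auto simp: T1M_def)
  then show ?thesis unfolding T1M_borel_def by (subst sets_measure_of) (auto intro: sigma_sets.Basic)
qed

lemma collar_iff_enters:
  assumes "\<omega> \<in> cross_section"
  shows "\<omega> \<in> dpi ` collar j S \<longleftrightarrow>
    (\<exists>v. enters j v \<and> dpi v = \<omega> \<and> endpoint_value (tangent_map (pairing j) v) \<in> S)"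
proof
  assume "\<omega> \<in> dpi ` collar j S"
  then obtain w where w: "w \<in> collar j S" "dpi w = \<omega>" by blast
  then have wT: "w \<in> T1H" and slope: "side_slope j (fst w) (snd w) > 0"
    and out: "\<And>k. k \<noteq> j \<Longrightarrow> side_fun k (fst w) > 0"
      "\<And>k. k \<noteq> partner j \<Longrightarrow> side_fun k (fst (tangent_map (pairing j) w)) > 0"
    and val: "endpoint_value (tangent_map (pairing j) w) \<in> S"
    by (auto simp: collar_def)
  let ?w' = "tangent_map (pairing j) w"
  have w'T: "?w' \<in> T1H" using tangent_map_in_T1H[OF pairing_in_Gamma2 wT] .
  have w': "dpi ?w' = \<omega>"
    using dpi_eq_iff[OF wT w'T] pairing_in_Gamma2 w(2) by blast
  have im: "Im (fst w) > 0" "Im (fst ?w') > 0"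
    using wT w'T by (auto simp: T1H_def upper_half_plane_def)
  have "side_fun j (fst w) \<le> 0"
  proof (rule ccontr)
    assume "\<not> side_fun j (fst w) \<le> 0"
    then have "fst w \<in> fundamental_domain"
      using out(1) im by (auto simp: fundamental_domain_iff) (metis not_le)
    then show False using interior_not_in_cross_section[OF wT] w(2) assms by blast
  qed
  moreover have "side_fun j (fst w) \<ge> 0"
  proof (rule ccontr)
    assume "\<not> side_fun j (fst w) \<ge> 0"
    then have "side_fun (partner j) (fst ?w') > 0"
      using side_fun_pairing[OF wT, of j] by (simp add: sgn_if split: if_splits)
    then have "fst ?w' \<in> fundamental_domain"
      using out(2) im by (auto simp: fundamental_domain_iff) metis
    then show False using interior_not_in_cross_section[OF w'T] w' assms by blast
  qed
  ultimately have "enters j w" using wT slope by (simp add: enters_def)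
  with w(2) val show "\<exists>v. enters j v \<and> dpi v = \<omega> \<and> endpoint_value (tangent_map (pairing j) v) \<in> S"
    by blast
next
  assume "\<exists>v. enters j v \<and> dpi v = \<omega> \<and> endpoint_value (tangent_map (pairing j) v) \<in> S"
  then obtain v where v: "enters j v" "dpi v = \<omega>" "endpoint_value (tangent_map (pairing j) v) \<in> S"
    by blast
  then have vT: "v \<in> T1H" and v0: "side_fun j (fst v) = 0" by (simp_all add: enters_def)
  have v'T: "tangent_map (pairing j) v \<in> T1H" using tangent_map_in_T1H[OF pairing_in_Gamma2 vT] .
  have im: "Im (fst v) > 0" "Im (fst (tangent_map (pairing j) v)) > 0"
    using vT v'T by (auto simp: T1H_def upper_half_plane_def)
  have "side_fun (partner j) (fst (tangent_map (pairing j) v)) = 0"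
    using side_fun_pairing[OF vT, of j] v0 by (simp add: sgn_0_0)
  then have "v \<in> collar j S"
    using v vT side_fun_pos_if_zero[OF im(1) v0] side_fun_pos_if_zero[OF im(2)]
    by (auto simp: collar_def enters_def)
  with v(2) show "\<omega> \<in> dpi ` collar j S" by blast
qed

lemma cross_section_cases:
  assumes "\<omega> \<in> cross_section"
  obtains j v where "enters j v" "\<omega> = dpi v" | j v where "grazes j v" "\<omega> = dpi v"
  using assms inward_vectors_iff unfolding cross_section_def by blast

text \<open>
  The preimage of \<open>S\<close> is the trace of an open set, together with the complement of the transversal
  orbits in case \<open>S\<close> contains the value on the tangent ones.
\<close>

lemma factor_map_measurable:
  "factor_map \<in> borel_measurable (restrict_space T1M_borel cross_section)"
proof (rule borel_measurableI)
  fix S :: "(real \<times> real) set" assume S: "open S"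
  have sub: "cross_section \<subseteq> T1M"
    by (auto simp: cross_section_def T1M_def inward_vectors_def)
  have space: "space T1M_borel = T1M" by (simp add: T1M_borel_def space_measure_of_conv)
  define U where "U S = (\<Union>j. dpi ` collar j S)" for S
  have U: "U S \<in> sets T1M_borel" if "open S" for S
    unfolding U_def by (intro sets.finite_UN dpi_image_measurable open_collar that) auto
  have U_iff: "\<omega> \<in> U S \<longleftrightarrow>
      (\<exists>j v. enters j v \<and> dpi v = \<omega> \<and> endpoint_value (tangent_map (pairing j) v) \<in> S)"
    if "\<omega> \<in> cross_section" for \<omega> S
    unfolding U_def using collar_iff_enters[OF that] by blast
  have enters: "dpi v \<in> U S \<longleftrightarrow> factor_map (dpi v) \<in> S" if "enters j v" for j v S
  proof -
    have X: "dpi v \<in> cross_section" using enters_imp_inward[OF that] by (simp add: cross_section_def)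
    show ?thesis unfolding U_iff[OF X] using factor_map_enters that by metis
  qed
  have grazes: "dpi v \<notin> U S" if "grazes j v" for j v S
  proof
    have vX: "v \<in> inward_vectors" using inward_if_enters_or_grazes that by blast
    assume "dpi v \<in> U S"
    then obtain k w where kw: "enters k w" "dpi w = dpi v"
      using U_iff[of "dpi v" S] vX by (auto simp: cross_section_def)
    then have "v = w" using enters_unique_lift[OF kw(1) vX] by simp
    then show False using kw(1) that side_zero_unique[of v j k]
      by (auto simp: enters_def grazes_def)
  qed
  let ?fix = "(1 / sqrt 2, 1 / sqrt 2) :: real \<times> real"
  have "factor_map -` S \<inter> cross_section
    = cross_section \<inter> (U S \<union> (if ?fix \<in> S then T1M - U UNIV else {}))"
  proof (rule set_eqI)
    fix \<omega>
    show "\<omega> \<in> factor_map -` S \<inter> cross_section \<longleftrightarrow>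
      \<omega> \<in> cross_section \<inter> (U S \<union> (if ?fix \<in> S then T1M - U UNIV else {}))"
    proof (cases "\<omega> \<in> cross_section")
      case True
      then show ?thesis
      proof (cases rule: cross_section_cases)
        case (1 j v)
        then show ?thesis using True enters[OF 1(1), of S] enters[OF 1(1), of UNIV] by auto
      next
        case (2 j v)
        then show ?thesis
          using True sub grazes[OF 2(1)] factor_map_grazes[OF 2(1)] by auto
      qed
    qed auto
  qed
  moreover have "U S \<union> (if ?fix \<in> S then T1M - U UNIV else {}) \<in> sets T1M_borel"
    using U[OF S] U[of UNIV] sets.compl_sets[of "U UNIV" T1M_borel] by (auto simp: space)
  ultimately show "factor_map -` S \<inter> space (restrict_space T1M_borel cross_section)
      \<in> sets (restrict_space T1M_borel cross_section)"
    using sub by (auto simp: sets_restrict_space space_restrict_space space Int_absorb2)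
qed

theorem theorem5:
  shows "\<exists>E :: tangent set \<Rightarrow> real \<times> real. is_factor_map E"
proof
  have range: "factor_map \<omega> \<in> quadrant" if "\<omega> \<in> cross_section" for \<omega>
    using that
  proof (cases rule: cross_section_cases)
    case (1 j v)
    then show ?thesis using factor_map_enters_values(1) by simp
  next
    case (2 j v)
    then show ?thesis using factor_map_grazes quadrant_map_fixed_point(2) by simp
  qed
  have commutes: "if return_times \<omega> \<noteq> {}
      then first_return \<omega> \<in> cross_section \<and> quadrant_map (factor_map \<omega>) = factor_map (first_return \<omega>)
      else quadrant_map (factor_map \<omega>) \<notin> quadrant" if "\<omega> \<in> cross_section" for \<omega>
    using that
  proof (cases rule: cross_section_cases)
    case (1 j v)
    then show ?thesis using factor_map_commutes_enters by simp
  next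
    case (2 j v)
    then show ?thesis
      using that grazes_returns_at_once[OF 2(1)] factor_map_grazes[OF 2(1)]
        quadrant_map_fixed_point(1) by simp
  qed
  show "is_factor_map factor_map"
    unfolding is_factor_map_def
    using range commutes factor_map_surj factor_map_measurable by blast
qed

end
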